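(* Let $3\le k<\ell$ be integers with $\ell\not\equiv 0,\pm1\pmod k$ and $\gcd(k,\ell)=1$. If $\ell\not\equiv\pm2\pmod k$ and $3\ell\not\equiv\pm1,\pm2\pmod k$, then \[\gamma(C^{k-}_\ell)\ge\frac13.\]
   Context: A $k$-uniform hypergraph $G$ has a finite vertex set $V(G)$ and an edge set $E(G)$ consisting of $k$-element subsets of $V(G)$. The codegree of a $(k-1)$-subset $S\subseteq V(G)$ is $|\{v\in V(G): S\cup\{v\}\in E(G)\}|$, where only $k$-sets $S\cup\{v\}$ count, and $\delta_{k-1}(G)$ is the minimum codegree over all $(k-1)$-subsets of $V(G)$. For a $k$-uniform hypergraph $F$, $\mathrm{ex}_{k-1}(n,F)$ is the largest value of $\delta_{k-1}(G)$ over $k$-uniform hypergraphs $G$ on $n$ vertices containing no copy of $F$ (as a not necessarily induced subhypergraph). The codegree Turán density of $F$ is $\gamma(F)=\lim_{n\to\infty}\mathrm{ex}_{k-1}(n,F)/n$ (this limit is known to exist). For $\ell\ge k+1$, the tight cycle $C^k_\ell$ is the $k$-uniform hypergraph on $\ell$ distinct vertices $v_1,\dots,v_\ell$ with edges $\{v_i,v_{i+1},\dots,v_{i+k-1}\}$ for all $i\in\{1,\dots,\ell\}$, indices modulo $\ell$. $C^{k-}_\ell$ is the hypergraph obtained from $C^k_\ell$ by removing a single edge. *)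

theory Defs
  imports Complex_Main "HOL-Number_Theory.Cong"
begin

record 'a hypergraph =
  verts :: "'a set"
  edges :: "'a set set"

definition uniform_hypergraph :: "nat \<Rightarrow> 'a hypergraph \<Rightarrow> bool" where
  "uniform_hypergraph k G \<longleftrightarrow>
     finite (verts G) \<and> (\<forall>e\<in>edges G. e \<subseteq> verts G \<and> card e = k)"

(* For a k-uniform G and card S = k - 1, a vertex v of S is never counted, since insert v S = S
   does not have k elements. *)
definition codegree :: "'a hypergraph \<Rightarrow> 'a set \<Rightarrow> nat" where
  "codegree G S = card {v \<in> verts G. S \<union> {v} \<in> edges G}"

(* Only meaningful if G has at least k - 1 vertices; otherwise this is Min of the empty set. *)
definition min_codegree :: "nat \<Rightarrow> 'a hypergraph \<Rightarrow> nat" where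
  "min_codegree k G = Min (codegree G ` {S. S \<subseteq> verts G \<and> card S = k - 1})"

definition contains_copy :: "'a hypergraph \<Rightarrow> 'b hypergraph \<Rightarrow> bool" where
  "contains_copy G F \<longleftrightarrow>
     (\<exists>f. inj_on f (verts F) \<and> f ` verts F \<subseteq> verts G \<and> (\<forall>e\<in>edges F. f ` e \<in> edges G))"

(* Every finite hypergraph is isomorphic to one whose vertices are natural numbers. *)
definition ex_codegree :: "nat \<Rightarrow> nat \<Rightarrow> 'b hypergraph \<Rightarrow> nat" where
  "ex_codegree k n F =
     Max {min_codegree k G | G :: nat hypergraph.
            uniform_hypergraph k G \<and> card (verts G) = n \<and> \<not> contains_copy G F}"

definition codegree_turan_density :: "nat \<Rightarrow> 'b hypergraph \<Rightarrow> real" where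
  "codegree_turan_density k F = lim (\<lambda>n. real (ex_codegree k n F) / real n)"

definition tight_cycle :: "nat \<Rightarrow> nat \<Rightarrow> nat hypergraph" where
  "tight_cycle k l =
     \<lparr>verts = {..<l}, edges = (\<lambda>i. (\<lambda>j. (i + j) mod l) ` {..<k}) ` {..<l}\<rparr>"

definition remove_edge :: "'a hypergraph \<Rightarrow> 'a set \<Rightarrow> 'a hypergraph" where
  "remove_edge G e = \<lparr>verts = verts G, edges = edges G - {e}\<rparr>"

end

theory Submission
  imports Defs "HOL-Library.FuncSet"
begin

text \<open>
  Two things have to be shown: the limit that defines the density exists, and for every \<open>n\<close>
  there is a hypergraph on \<open>n\<close> vertices without a copy of the cycle and with codegrees about \<open>n / 3\<close>.

  The limit. Sample \<open>m\<close> vertices of an extremal hypergraph on \<open>N\<close> vertices, independently and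
  with \<open>N\<close> much larger than \<open>m\<close>. An exponential moment bound shows that for every
  \<open>(k - 1)\<close>-set the proportion of neighbours in the sample drops by \<open>\<epsilon>\<close> with probability
  exponentially small in \<open>m\<close>, so some injective sample is good for all \<open>(k - 1)\<close>-sets at once
  (\<open>dense_sample_exists\<close>). Hence the normalised extremal codegree is decreasing up to \<open>\<epsilon>\<close>,
  and it converges.

  The construction. Colour the vertex \<open>v\<close> by \<open>v mod 3\<close>, and let the edges be the \<open>k\<close>-sets whose
  numbers of vertices of each colour form a triple in a fixed set \<open>T\<close>, the pattern. If every
  \<open>(k - 1)\<close>-set can be completed by some colour, then the codegrees are \<open>n / 3 - O(1)\<close>. Along a
  tight cycle, the next edge arises by exchanging one vertex, so its triple is equal or adjacent to
  the previous one. The pattern is chosen such that all edges that can be reached in this way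
  have the same number \<open>m\<close> of vertices of some colour \<open>h\<close>. If a tight cycle of length \<open>l\<close> minus
  one edge were present, then counting incidences between its vertices of colour \<open>h\<close> and all
  \<open>l\<close> windows of \<open>k\<close> consecutive vertices gives a multiple of \<open>k\<close>; all windows contribute \<open>m\<close>,
  except that the missing one may be off by one. So \<open>l m \<equiv> 0, \<plusminus>1 (mod k)\<close>, which leaves only
  \<open>m \<in> {0, p, q, k}\<close>, where \<open>p\<close> is the inverse of \<open>l\<close> modulo \<open>k\<close> and \<open>q = k - p\<close>
  (\<open>pattern_graph_free\<close>, \<open>exceptional_counts\<close>).

  The pattern therefore only has to keep \<open>m\<close> away from these four exceptional counts. In the lattice
  of all triples \<open>(a, b, c)\<close> with \<open>b \<equiv> c (mod 3)\<close>, every \<open>(k - 1)\<close>-set can be completed in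
  exactly one way and no two points are adjacent, so \<open>h\<close> can be chosen freely; only
  points all of whose coordinates are exceptional are bad. There are at most three of them, all on
  the boundary of the triangle of triples: corners, or points with coordinates \<open>p\<close>, \<open>q\<close> and \<open>0\<close>.
  A bad point is replaced by its neighbours along the side of the triangle (one neighbour
  for a corner). Such a neighbour is adjacent to at most one other point of the
  pattern, and with this point it shares the coordinate that has been increased, which is now
  \<open>p + 1\<close>, \<open>q + 1\<close> or \<open>1\<close>. The congruence conditions on \<open>l\<close> say that \<open>p, q \<notin> {1, 3}\<close> and
  that \<open>p\<close> and \<open>q\<close> do not differ by \<open>1\<close> or \<open>3\<close>. This makes the increased coordinates
  unexceptional and keeps the new points of different bad points apart
  (\<open>codegree_pattern_exists\<close>).
\<close>

section \<open>Existence of the codegree density\<close>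

text \<open>Chernoff's bound in counting form: weight a function by \<open>exp (- s)\<close> to the number of its hits.
  The total weight factorises over the arguments, and a function with at most \<open>t\<close> hits has weight at
  least \<open>exp (- s t)\<close>.\<close>
lemma card_functions_with_few_hits:
  fixes A V :: "'a set" and J :: "'i set" and s t :: real
  assumes "finite V" "finite J" "A \<subseteq> V" "0 \<le> s"
  shows "real (card {h \<in> J \<rightarrow>\<^sub>E V. real (card {j\<in>J. h j \<in> A}) \<le> t})
    \<le> exp (s * t) * (real (card V) - real (card A) * (1 - exp (- s))) ^ card J"
proof -
  let ?w = "\<lambda>v. if v \<in> A then exp (- s) else (1::real)"
  have fin: "finite (J \<rightarrow>\<^sub>E V)"
    using assms by (simp add: finite_PiE)
  have weight: "(\<Prod>j\<in>J. ?w (h j)) = exp (- s * real (card {j\<in>J. h j \<in> A}))" for h :: "'i \<Rightarrow> 'a"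
  proof -
    have "(\<Prod>j\<in>J. ?w (h j)) = (\<Prod>j\<in>{j\<in>J. h j \<in> A}. exp (- s))"
      using assms by (intro prod.mono_neutral_cong_right) auto
    also have "\<dots> = exp (- s * real (card {j\<in>J. h j \<in> A}))"
      by (simp add: exp_of_nat_mult[symmetric] mult.commute)
    finally show ?thesis .
  qed
  have total: "(\<Sum>v\<in>V. ?w v) = real (card V) - real (card A) * (1 - exp (- s))"
  proof -
    have "(\<Sum>v\<in>V. ?w v) = (\<Sum>v\<in>A. exp (- s)) + (\<Sum>v\<in>V - A. 1)"
      using assms by (subst sum.subset_diff[OF assms(3,1)]) simp
    also have "\<dots> = real (card A) * exp (- s) + (real (card V) - real (card A))"
      using assms card_mono[OF assms(1,3)] by (simp add: card_Diff_subset finite_subset of_nat_diff)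
    finally show ?thesis by (simp add: algebra_simps)
  qed
  have "real (card {h \<in> J \<rightarrow>\<^sub>E V. real (card {j\<in>J. h j \<in> A}) \<le> t})
      = (\<Sum>h\<in>{h \<in> J \<rightarrow>\<^sub>E V. real (card {j\<in>J. h j \<in> A}) \<le> t}. 1)"
    by simp
  also have "\<dots> \<le> (\<Sum>h\<in>{h \<in> J \<rightarrow>\<^sub>E V. real (card {j\<in>J. h j \<in> A}) \<le> t}. exp (s * t) * (\<Prod>j\<in>J. ?w (h j)))"
  proof (rule sum_mono)
    fix h assume "h \<in> {h \<in> J \<rightarrow>\<^sub>E V. real (card {j\<in>J. h j \<in> A}) \<le> t}"
    then have "s * real (card {j\<in>J. h j \<in> A}) \<le> s * t"
      using assms by (intro mult_left_mono) auto
    then show "1 \<le> exp (s * t) * (\<Prod>j\<in>J. ?w (h j))"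
      unfolding weight exp_add[symmetric] by simp
  qed
  also have "\<dots> \<le> (\<Sum>h\<in>J \<rightarrow>\<^sub>E V. exp (s * t) * (\<Prod>j\<in>J. ?w (h j)))"
    using fin by (intro sum_mono2) (auto simp del: fun_upd_apply intro!: prod_nonneg mult_nonneg_nonneg)
  also have "\<dots> = exp (s * t) * (\<Prod>j\<in>J. \<Sum>v\<in>V. ?w v)"
    using assms by (subst prod_sum_PiE) (auto simp: sum_distrib_left)
  also have "\<dots> = exp (s * t) * (real (card V) - real (card A) * (1 - exp (- s))) ^ card J"
    unfolding total by simp
  finally show ?thesis .
qed

lemma card_noninjective_functions:
  assumes "finite V"
  shows "real (card {f \<in> {..<m} \<rightarrow>\<^sub>E V. \<not> inj_on f {..<m}}) * real (card V) \<le> real m ^ 2 * real (card V) ^ m"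
proof -
  let ?P = "{(i, j). i < m \<and> j < m \<and> i \<noteq> j}"
  let ?C = "\<lambda>(i, j). {f \<in> {..<m} \<rightarrow>\<^sub>E V. f i = f j}"
  have P: "?P \<subseteq> {..<m} \<times> {..<m}" by auto
  then have finP: "finite ?P" using finite_subset by blast
  have cardP: "card ?P \<le> m ^ 2"
    using card_mono[OF _ P] by (simp add: power2_eq_square)
  have fin: "finite ({..<m} \<rightarrow>\<^sub>E V)" using assms by (simp add: finite_PiE)
  have C: "card (?C x) * card V \<le> card V ^ m" if x0: "x \<in> ?P" for x
  proof -
    obtain i j where x: "x = (i, j)" "i < m" "j < m" "i \<noteq> j"
      using x0 by (cases x) simp
    have "card (?C x) \<le> card (({..<m} - {j}) \<rightarrow>\<^sub>E V)"
    proof (rule card_inj_on_le[where f = "\<lambda>f. restrict f ({..<m} - {j})"])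
      show "inj_on (\<lambda>f. restrict f ({..<m} - {j})) (?C x)"
      proof (rule inj_onI)
        fix f g assume f: "f \<in> ?C x" and g: "g \<in> ?C x"
          and eq: "restrict f ({..<m} - {j}) = restrict g ({..<m} - {j})"
        have *: "f l = g l" if "l < m" "l \<noteq> j" for l
          using fun_cong[OF eq, of l] that by simp
        show "f = g"
        proof (rule PiE_ext)
          show "f \<in> {..<m} \<rightarrow>\<^sub>E V" "g \<in> {..<m} \<rightarrow>\<^sub>E V" using f g x by auto
          have "f i = f j" "g i = g j" using f g x(1) by simp_all
          then have "f j = g j" using *[OF x(2,4)] by metis
          then show "f l = g l" if "l \<in> {..<m}" for l
            using * that by (cases "l = j") simp_all
        qed
      qed
      show "(\<lambda>f. restrict f ({..<m} - {j})) ` ?C x \<subseteq> ({..<m} - {j}) \<rightarrow>\<^sub>E V"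
      proof (rule image_subsetI)
        fix f assume "f \<in> ?C x"
        then have "f \<in> {..<m} \<rightarrow>\<^sub>E V" using x(1) by simp
        then show "restrict f ({..<m} - {j}) \<in> ({..<m} - {j}) \<rightarrow>\<^sub>E V" by auto
      qed
      show "finite (({..<m} - {j}) \<rightarrow>\<^sub>E V)" using assms by (simp add: finite_PiE)
    qed
    also have "card (({..<m} - {j}) \<rightarrow>\<^sub>E V) = card V ^ (m - 1)"
      using x by (subst card_funcsetE) auto
    finally have "card (?C x) * card V \<le> card V ^ (m - 1) * card V" by simp
    also have "\<dots> = card V ^ m" using x(2) by (cases m) simp_all
    finally show ?thesis .
  qed
  have "{f \<in> {..<m} \<rightarrow>\<^sub>E V. \<not> inj_on f {..<m}} \<subseteq> (\<Union>x\<in>?P. ?C x)"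
    unfolding inj_on_def by fastforce
  then have "card {f \<in> {..<m} \<rightarrow>\<^sub>E V. \<not> inj_on f {..<m}} \<le> card (\<Union>x\<in>?P. ?C x)"
    using fin finP by (intro card_mono finite_UN_I) auto
  also have "\<dots> \<le> (\<Sum>x\<in>?P. card (?C x))"
    using finP by (rule card_UN_le)
  finally have "card {f \<in> {..<m} \<rightarrow>\<^sub>E V. \<not> inj_on f {..<m}} * card V \<le> (\<Sum>x\<in>?P. card (?C x)) * card V"
    by (rule mult_right_mono) simp
  also have "\<dots> = (\<Sum>x\<in>?P. card (?C x) * card V)" by (rule sum_distrib_right)
  also have "\<dots> \<le> (\<Sum>x\<in>?P. card V ^ m)" by (rule sum_mono) (rule C)
  also have "\<dots> \<le> m ^ 2 * card V ^ m" using cardP by simp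
  finally show ?thesis
    by (metis (mono_tags, lifting) of_nat_le_iff of_nat_mult of_nat_power)
qed

text \<open>The set whose neighbours are counted is itself sampled. Fixing the values on \<open>I\<close> fixes this set, and
  the remaining arguments are still free, so the Chernoff bound applies to them.\<close>
lemma card_functions_with_deficient_set:
  fixes V :: "'a set" and nbr :: "'a set \<Rightarrow> 'a set" and s t :: real
  assumes V: "finite V" and s: "0 \<le> s"
    and I: "I \<subseteq> {..<m}" "card I = r"
    and nbr: "\<And>S. S \<subseteq> V \<Longrightarrow> card S = r \<Longrightarrow> nbr S \<subseteq> V \<and> a * real (card V) \<le> real (card (nbr S))"
    and a: "0 \<le> a" "a \<le> 1"
  shows "real (card {f \<in> {..<m} \<rightarrow>\<^sub>E V. inj_on f {..<m} \<and> real (card {j\<in>{..<m}. f j \<in> nbr (f ` I)}) \<le> t})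
    \<le> real (card V) ^ m * (exp (s * t) * (1 - a * (1 - exp (- s))) ^ (m - r))"
proof -
  let ?J = "{..<m} - I"
  let ?N = "real (card V)"
  let ?c = "exp (s * t) * (1 - a * (1 - exp (- s))) ^ (m - r)"
  let ?bad = "{f \<in> {..<m} \<rightarrow>\<^sub>E V. inj_on f {..<m} \<and> real (card {j\<in>{..<m}. f j \<in> nbr (f ` I)}) \<le> t}"
  let ?G = "{g \<in> I \<rightarrow>\<^sub>E V. inj_on g I}"
  let ?B = "\<lambda>g. {f \<in> ?bad. restrict f I = g}"
  have finI: "finite I" using I finite_subset by blast
  have finG: "finite (I \<rightarrow>\<^sub>E V)" using V finI by (simp add: finite_PiE)
  have fin: "finite ({..<m} \<rightarrow>\<^sub>E V)" using V by (simp add: finite_PiE)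
  have cJ: "card ?J = m - r" using I finI by (simp add: card_Diff_subset)
  have rm: "r \<le> m" using I card_mono[of "{..<m}" I] by simp
  have e1: "0 \<le> 1 - exp (- s)" "1 - exp (- s) \<le> 1" using s by auto
  have B: "real (card (?B g)) \<le> ?N ^ (m - r) * ?c" if g: "g \<in> ?G" for g
  proof -
    let ?S = "g ` I"
    have S: "?S \<subseteq> V" "card ?S = r" using g I by (auto simp: card_image)
    let ?H = "{h \<in> ?J \<rightarrow>\<^sub>E V. real (card {j\<in>?J. h j \<in> nbr ?S}) \<le> t}"
    have "card (?B g) \<le> card ?H"
    proof (rule card_inj_on_le[where f = "\<lambda>f. restrict f ?J"])
      show "inj_on (\<lambda>f. restrict f ?J) (?B g)"
      proof (rule inj_onI)
        fix f f' assume f: "f \<in> ?B g" and f': "f' \<in> ?B g" and eq: "restrict f ?J = restrict f' ?J"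
        have eqI: "restrict f I = restrict f' I" using f f' by simp
        show "f = f'"
        proof (rule PiE_ext)
          show "f \<in> {..<m} \<rightarrow>\<^sub>E V" "f' \<in> {..<m} \<rightarrow>\<^sub>E V" using f f' by auto
          show "f l = f' l" if "l \<in> {..<m}" for l
            using fun_cong[OF eq, of l] fun_cong[OF eqI, of l] that by (cases "l \<in> I") auto
        qed
      qed
      show "(\<lambda>f. restrict f ?J) ` ?B g \<subseteq> ?H"
      proof (rule image_subsetI)
        fix f assume f: "f \<in> ?B g"
        then have fg: "f ` I = ?S" by auto
        have "card {j\<in>?J. restrict f ?J j \<in> nbr ?S} \<le> card {j\<in>{..<m}. f j \<in> nbr (f ` I)}"
          unfolding fg by (rule card_mono) auto
        then show "restrict f ?J \<in> ?H" using f by auto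
      qed
      show "finite ?H" using V by (simp add: finite_PiE)
    qed
    then have "real (card (?B g)) \<le> real (card ?H)" by simp
    also have "\<dots> \<le> exp (s * t) * (?N - real (card (nbr ?S)) * (1 - exp (- s))) ^ card ?J"
      using V s nbr[OF S] by (intro card_functions_with_few_hits) auto
    also have "\<dots> \<le> exp (s * t) * (?N * (1 - a * (1 - exp (- s)))) ^ card ?J"
    proof (intro mult_left_mono power_mono)
      have "a * ?N * (1 - exp (- s)) \<le> real (card (nbr ?S)) * (1 - exp (- s))"
        using nbr[OF S] e1 by (intro mult_right_mono) auto
      then show "?N - real (card (nbr ?S)) * (1 - exp (- s)) \<le> ?N * (1 - a * (1 - exp (- s)))"
        by (simp add: algebra_simps)
      have "real (card (nbr ?S)) \<le> ?N" using nbr[OF S] V card_mono by auto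
      then have "real (card (nbr ?S)) * (1 - exp (- s)) \<le> ?N * 1"
        using e1 by (intro mult_mono) auto
      then show "0 \<le> ?N - real (card (nbr ?S)) * (1 - exp (- s))" by simp
    qed simp
    also have "\<dots> = ?N ^ (m - r) * ?c" unfolding cJ by (simp add: power_mult_distrib)
    finally show ?thesis .
  qed
  have c0: "0 \<le> ?c" 
  proof -
    have "a * (1 - exp (- s)) \<le> 1 * 1" using a e1 by (intro mult_mono) auto
    then show ?thesis by simp
  qed
  have "?bad \<subseteq> (\<Union>g\<in>?G. ?B g)"
  proof
    fix f assume f: "f \<in> ?bad"
    then have "restrict f I \<in> ?G"
      using I by (auto simp: inj_on_def)
    then show "f \<in> (\<Union>g\<in>?G. ?B g)" using f by blast
  qed
  then have "card ?bad \<le> card (\<Union>g\<in>?G. ?B g)"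
    using fin finG by (intro card_mono finite_UN_I) auto
  also have "\<dots> \<le> (\<Sum>g\<in>?G. card (?B g))"
    using finG by (intro card_UN_le) auto
  finally have "real (card ?bad) \<le> (\<Sum>g\<in>?G. real (card (?B g)))"
    unfolding of_nat_sum[symmetric] of_nat_le_iff .
  also have "\<dots> \<le> (\<Sum>g\<in>?G. ?N ^ (m - r) * ?c)" by (intro sum_mono B)
  also have "\<dots> = real (card ?G) * (?N ^ (m - r) * ?c)" by simp
  also have "\<dots> \<le> ?N ^ r * (?N ^ (m - r) * ?c)"
  proof (rule mult_right_mono)
    have "card ?G \<le> card (I \<rightarrow>\<^sub>E V)" using finG by (intro card_mono) auto
    also have "\<dots> = card V ^ r" using finI I by (simp add: card_funcsetE)
    finally show "real (card ?G) \<le> ?N ^ r" by (metis of_nat_le_iff of_nat_power)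
  qed (use c0 in simp)
  also have "\<dots> = ?N ^ m * ?c" using rm by (simp add: power_add[symmetric] mult.assoc[symmetric])
  finally show ?thesis .
qed

text \<open>Union bound over non-injective samples and over all \<open>r\<close>-sets \<open>I\<close> of sampled positions.\<close>
lemma dense_sample_exists:
  fixes V :: "'a set" and nbr :: "'a set \<Rightarrow> 'a set" and s t :: real
  assumes V: "finite V" "V \<noteq> {}" and s: "0 \<le> s" and r: "r \<le> m"
    and nbr: "\<And>S. S \<subseteq> V \<Longrightarrow> card S = r \<Longrightarrow> nbr S \<subseteq> V \<and> a * real (card V) \<le> real (card (nbr S))"
    and a: "0 \<le> a" "a \<le> 1"
    and few: "real m ^ 2 / real (card V) + real m ^ r * (exp (s * t) * (1 - a * (1 - exp (- s))) ^ (m - r)) < 1"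
  shows "\<exists>f. f ` {..<m} \<subseteq> V \<and> inj_on f {..<m} \<and>
    (\<forall>I. I \<subseteq> {..<m} \<longrightarrow> card I = r \<longrightarrow> t < real (card {j\<in>{..<m}. f j \<in> nbr (f ` I)}))"
proof -
  let ?N = "real (card V)"
  let ?c = "exp (s * t) * (1 - a * (1 - exp (- s))) ^ (m - r)"
  let ?\<Omega> = "{..<m} \<rightarrow>\<^sub>E V"
  let ?D = "\<lambda>I. {f \<in> ?\<Omega>. inj_on f {..<m} \<and> real (card {j\<in>{..<m}. f j \<in> nbr (f ` I)}) \<le> t}"
  let ?K = "{I. I \<subseteq> {..<m} \<and> card I = r}"
  let ?X = "{f \<in> ?\<Omega>. \<not> inj_on f {..<m}}"
  have fin: "finite ?\<Omega>" using V by (simp add: finite_PiE)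
  have N: "?N > 0" using V by (simp add: card_gt_0_iff)
  have "a * (1 - exp (- s)) \<le> 1 * 1" using a s by (intro mult_mono) auto
  then have c0: "0 \<le> ?c" by simp
  have finK: "finite ?K" by simp
  have "card ?K = m choose r" using n_subsets[of "{..<m}" r] by simp
  also have "\<dots> \<le> m ^ r" using r by (rule binomial_le_pow)
  finally have cK: "real (card ?K) \<le> real m ^ r" by (metis of_nat_le_iff of_nat_power)
  have X: "real (card ?X) \<le> ?N ^ m * (real m ^ 2 / ?N)"
    using card_noninjective_functions[OF V(1), of m] N by (simp add: field_simps)
  have "real (card (\<Union>I\<in>?K. ?D I)) \<le> (\<Sum>I\<in>?K. real (card (?D I)))"
    unfolding of_nat_sum[symmetric] of_nat_le_iff by (rule card_UN_le[OF finK])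
  also have "\<dots> \<le> (\<Sum>I\<in>?K. ?N ^ m * ?c)"
    using V s nbr a by (intro sum_mono card_functions_with_deficient_set) auto
  also have "\<dots> = real (card ?K) * (?N ^ m * ?c)" by simp
  also have "\<dots> \<le> real m ^ r * (?N ^ m * ?c)" using cK c0 by (intro mult_right_mono) auto
  finally have D: "real (card (\<Union>I\<in>?K. ?D I)) \<le> ?N ^ m * (real m ^ r * ?c)" by (simp add: mult_ac)
  have "real (card (?X \<union> (\<Union>I\<in>?K. ?D I))) \<le> real (card ?X) + real (card (\<Union>I\<in>?K. ?D I))"
    using card_Un_le[of ?X "\<Union>I\<in>?K. ?D I"] by linarith
  also have "\<dots> \<le> ?N ^ m * (real m ^ 2 / ?N + real m ^ r * ?c)"
    using X D by (simp add: distrib_left)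
  also have "\<dots> < ?N ^ m * 1" using few N by (intro mult_strict_left_mono) auto
  also have "\<dots> = real (card ?\<Omega>)" by (simp add: card_funcsetE)
  finally have "?X \<union> (\<Union>I\<in>?K. ?D I) \<noteq> ?\<Omega>" by auto
  then obtain f where f: "f \<in> ?\<Omega>" "f \<notin> ?X" "f \<notin> (\<Union>I\<in>?K. ?D I)" by blast
  show ?thesis
  proof (intro exI[of _ f] conjI allI impI)
    show "f ` {..<m} \<subseteq> V" using f by auto
    show "inj_on f {..<m}" using f by auto
    show "t < real (card {j\<in>{..<m}. f j \<in> nbr (f ` I)})" if "I \<subseteq> {..<m}" "card I = r" for I
      using f that by force
  qed
qed

lemma min_codegree_le_codegree:
  assumes "uniform_hypergraph k G" "S \<subseteq> verts G" "card S = k - 1"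
  shows "min_codegree k G \<le> codegree G S"
  unfolding min_codegree_def using assms by (intro Min_le) (auto simp: uniform_hypergraph_def)

lemma min_codegree_attained:
  assumes "uniform_hypergraph k G" "k - 1 \<le> card (verts G)"
  obtains S where "S \<subseteq> verts G" "card S = k - 1" "min_codegree k G = codegree G S"
proof -
  have fin: "finite (verts G)" using assms(1) by (simp add: uniform_hypergraph_def)
  obtain S0 where "S0 \<subseteq> verts G" "card S0 = k - 1"
    using obtain_subset_with_card_n[OF assms(2)] by blast
  then have "codegree G ` {S. S \<subseteq> verts G \<and> card S = k - 1} \<noteq> {}" by blast
  moreover have "finite {S. S \<subseteq> verts G \<and> card S = k - 1}" using fin by simp
  ultimately have "min_codegree k G \<in> codegree G ` {S. S \<subseteq> verts G \<and> card S = k - 1}"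
    unfolding min_codegree_def by (intro Min_in finite_imageI)
  then show ?thesis using that by blast
qed

lemma min_codegree_le_card:
  assumes "uniform_hypergraph k G" "k - 1 \<le> card (verts G)"
  shows "min_codegree k G \<le> card (verts G)"
proof -
  obtain S where "min_codegree k G = codegree G S" using min_codegree_attained[OF assms] by blast
  also have "codegree G S \<le> card (verts G)"
    unfolding codegree_def using assms(1) by (intro card_mono) (auto simp: uniform_hypergraph_def)
  finally show ?thesis .
qed

text \<open>The set whose maximum is the extremal codegree.\<close>
definition free_codegrees :: "nat \<Rightarrow> nat \<Rightarrow> 'b hypergraph \<Rightarrow> nat set" where
  "free_codegrees k n F = {min_codegree k G | G :: nat hypergraph.
     uniform_hypergraph k G \<and> card (verts G) = n \<and> \<not> contains_copy G F}"

lemma ex_codegree_eq: "ex_codegree k n F = Max (free_codegrees k n F)"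
  by (simp add: ex_codegree_def free_codegrees_def)

lemma finite_free_codegrees:
  assumes "k - 1 \<le> n"
  shows "finite (free_codegrees k n F)"
proof (rule finite_subset)
  show "free_codegrees k n F \<subseteq> {..n}"
    unfolding free_codegrees_def using assms min_codegree_le_card by fastforce
qed simp

lemma min_codegree_le_ex_codegree:
  fixes G :: "nat hypergraph"
  assumes "uniform_hypergraph k G" "card (verts G) = n" "\<not> contains_copy G F" "k - 1 \<le> n"
  shows "min_codegree k G \<le> ex_codegree k n F"
proof -
  have "min_codegree k G \<in> free_codegrees k n F" using assms unfolding free_codegrees_def by blast
  then show ?thesis unfolding ex_codegree_eq by (rule Max_ge[OF finite_free_codegrees[OF assms(4)]])
qed

lemma ex_codegree_attained:
  assumes "edges F \<noteq> {}" "k - 1 \<le> n"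
  obtains G :: "nat hypergraph" where "uniform_hypergraph k G" "card (verts G) = n"
    "\<not> contains_copy G F" "min_codegree k G = ex_codegree k n F"
proof -
  let ?E = "\<lparr>verts = {..<n}, edges = {}\<rparr> :: nat hypergraph"
  have "uniform_hypergraph k ?E" "card (verts ?E) = n" "\<not> contains_copy ?E F"
    using assms(1) by (auto simp: uniform_hypergraph_def contains_copy_def)
  then have "min_codegree k ?E \<in> free_codegrees k n F" unfolding free_codegrees_def by blast
  then have "ex_codegree k n F \<in> free_codegrees k n F"
    unfolding ex_codegree_eq using finite_free_codegrees[OF assms(2)] by (intro Max_in) auto
  then show ?thesis using that unfolding free_codegrees_def by auto
qed

lemma ex_codegree_le:
  assumes "edges F \<noteq> {}" "k - 1 \<le> n"
  shows "ex_codegree k n F \<le> n"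
  using ex_codegree_attained[OF assms] min_codegree_le_card assms(2) by metis

text \<open>The sampled hypergraph. For injective \<open>f\<close> it is an induced subhypergraph of \<open>G\<close>, so it
  inherits the absence of copies.\<close>
definition pullback :: "nat \<Rightarrow> (nat \<Rightarrow> 'a) \<Rightarrow> nat \<Rightarrow> 'a hypergraph \<Rightarrow> nat hypergraph" where
  "pullback k f m G = \<lparr>verts = {..<m}, edges = {e. e \<subseteq> {..<m} \<and> card e = k \<and> f ` e \<in> edges G}\<rparr>"

lemma pullback_uniform: "uniform_hypergraph k (pullback k f m G)"
  by (auto simp: pullback_def uniform_hypergraph_def)

lemma pullback_free:
  assumes "\<not> contains_copy G F" "inj_on f {..<m}" "f ` {..<m} \<subseteq> verts G"
  shows "\<not> contains_copy (pullback k f m G) F"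
proof
  assume "contains_copy (pullback k f m G) F"
  then obtain g where g: "inj_on g (verts F)" "g ` verts F \<subseteq> {..<m}" "\<forall>e\<in>edges F. f ` g ` e \<in> edges G"
    unfolding contains_copy_def pullback_def by auto
  have "inj_on (f \<circ> g) (verts F)"
    using g(1,2) assms(2) by (meson comp_inj_on inj_on_subset)
  moreover have "(f \<circ> g) ` verts F \<subseteq> verts G" using g(2) assms(3) by auto
  moreover have "\<forall>e\<in>edges F. (f \<circ> g) ` e \<in> edges G" using g(3) by (simp add: image_comp)
  ultimately show False using assms(1) unfolding contains_copy_def by blast
qed

text \<open>A good sample of an extremal hypergraph on \<open>N\<close> vertices is a competitor on \<open>m\<close> vertices.\<close>
lemma ex_codegree_sampling:
  fixes F :: "'b hypergraph" and k :: nat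
  defines "r \<equiv> k - 1"
  assumes F: "edges F \<noteq> {}" and mN: "r \<le> m" "r \<le> N" "0 < N"
    and s: "0 \<le> s" and a: "a = real (ex_codegree k N F) / real N"
    and few: "real m ^ 2 / real N + real m ^ r * (exp (s * t) * (1 - a * (1 - exp (- s))) ^ (m - r)) < 1"
  shows "t \<le> real (ex_codegree k m F)"
proof -
  obtain G :: "nat hypergraph" where G: "uniform_hypergraph k G" "card (verts G) = N" "\<not> contains_copy G F"
    "min_codegree k G = ex_codegree k N F"
    using ex_codegree_attained[OF F mN(2)[unfolded r_def]] by blast
  have fin: "finite (verts G)" using G(1) by (simp add: uniform_hypergraph_def)
  have a01: "0 \<le> a" "a \<le> 1"
    using ex_codegree_le[OF F mN(2)[unfolded r_def]] mN(3) unfolding a by (simp_all add: divide_le_eq)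
  let ?nbr = "\<lambda>S. {v \<in> verts G. S \<union> {v} \<in> edges G}"
  have nbr: "?nbr S \<subseteq> verts G \<and> a * real (card (verts G)) \<le> real (card (?nbr S))"
    if "S \<subseteq> verts G" "card S = r" for S
    using min_codegree_le_codegree[OF G(1) that(1)] that(2) mN(3) unfolding a G(2) G(4) r_def codegree_def
    by auto
  have ne: "verts G \<noteq> {}" using G(2) mN(3) by auto
  have "\<exists>f. f ` {..<m} \<subseteq> verts G \<and> inj_on f {..<m} \<and>
      (\<forall>I. I \<subseteq> {..<m} \<longrightarrow> card I = r \<longrightarrow> t < real (card {j\<in>{..<m}. f j \<in> ?nbr (f ` I)}))"
    by (rule dense_sample_exists[where nbr = ?nbr, OF fin ne s mN(1) nbr a01 few[folded G(2)]])
  then obtain f where f: "f ` {..<m} \<subseteq> verts G" "inj_on f {..<m}"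
    "\<forall>I. I \<subseteq> {..<m} \<longrightarrow> card I = r \<longrightarrow> t < real (card {j\<in>{..<m}. f j \<in> ?nbr (f ` I)})"
    by (elim exE conjE)
  let ?H = "pullback k f m G"
  have V: "verts ?H = {..<m}" by (simp add: pullback_def)
  obtain I where I: "I \<subseteq> {..<m}" "card I = r" "min_codegree k ?H = codegree ?H I"
    using min_codegree_attained[OF pullback_uniform, of k f m G] mN(1) unfolding V r_def by auto
  have "{j\<in>{..<m}. f j \<in> ?nbr (f ` I)} \<subseteq> {j \<in> verts ?H. I \<union> {j} \<in> edges ?H}"
  proof
    fix j assume j: "j \<in> {j\<in>{..<m}. f j \<in> ?nbr (f ` I)}"
    then have e: "f ` (I \<union> {j}) \<in> edges G" by simp
    have sub: "I \<union> {j} \<subseteq> {..<m}" using I(1) j by auto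
    have "card (f ` (I \<union> {j})) = k" using e G(1) unfolding uniform_hypergraph_def by blast
    then have "card (I \<union> {j}) = k" using card_image[OF inj_on_subset[OF f(2) sub]] by simp
    then show "j \<in> {j \<in> verts ?H. I \<union> {j} \<in> edges ?H}" using e sub j unfolding pullback_def by simp
  qed
  then have "card {j\<in>{..<m}. f j \<in> ?nbr (f ` I)} \<le> codegree ?H I"
    unfolding codegree_def V by (intro card_mono) auto
  then have "t < real (min_codegree k ?H)" using f(3)[rule_format, OF I(1,2)] I(3) by linarith
  moreover have "min_codegree k ?H \<le> ex_codegree k m F"
    using pullback_uniform pullback_free[OF G(3) f(2,1)] mN(1)
    by (intro min_codegree_le_ex_codegree) (auto simp: V r_def)
  ultimately show ?thesis by linarith
qed

text \<open>The failure probability of one set at the optimal rate \<open>s = \<epsilon> / 2\<close>. The factor \<open>exp r\<close> pays for the \<open>r\<close>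
  positions that are used up by the set itself.\<close>
lemma deficiency_bound:
  fixes a \<epsilon> :: real
  assumes "0 \<le> a" "a \<le> 1" "0 < \<epsilon>" "\<epsilon> \<le> 1" "r \<le> m"
  shows "exp (\<epsilon> / 2 * ((a - \<epsilon>) * real m)) * (1 - a * (1 - exp (- (\<epsilon> / 2)))) ^ (m - r)
    \<le> exp (real r) * exp (- (\<epsilon>\<^sup>2 / 4 * real m))"
proof -
  \<comment> \<open>Since \<open>1 - exp (- s) \<ge> s - s\<^sup>2\<close>, the exponent is at most \<open>r + m (s\<^sup>2 - s \<epsilon>)\<close>, minimal at \<open>s = \<epsilon> / 2\<close>.\<close>
  define s where "s = \<epsilon> / 2"
  define u where "u = s - s\<^sup>2"
  have s: "0 < s" "s \<le> 1 / 2" "\<epsilon> = 2 * s" using assms by (simp_all add: s_def)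
  have u: "0 \<le> u" "u \<le> 1"
  proof -
    have "s\<^sup>2 \<le> s * 1" unfolding power2_eq_square using s by (intro mult_left_mono) auto
    then show "0 \<le> u" by (simp add: u_def)
    show "u \<le> 1" using s zero_le_power2[of s] unfolding u_def by linarith
  qed
  have "exp (- s) \<le> 1 - u"
  proof -
    have "exp (- s) = 1 / exp s" by (simp add: exp_minus inverse_eq_divide)
    also have "\<dots> \<le> 1 / (1 + s)" using s by (intro divide_left_mono) (auto simp: exp_ge_add_one_self)
    also have "\<dots> \<le> 1 - u"
    proof -
      have "(1 - u) * (1 + s) = 1 + s ^ 3" unfolding u_def by (simp add: algebra_simps power2_eq_square power3_eq_cube)
      then have "1 \<le> (1 - u) * (1 + s)" using s by simp
      then show ?thesis using s by (simp add: divide_le_eq)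
    qed
    finally show ?thesis .
  qed
  then have "a * u \<le> a * (1 - exp (- s))" using assms by (intro mult_left_mono) auto
  moreover have "1 + (- (a * u)) \<le> exp (- (a * u))" by (rule exp_ge_add_one_self)
  ultimately have base: "1 - a * (1 - exp (- s)) \<le> exp (- (a * u))" by linarith
  have "a * (1 - exp (- s)) \<le> 1 * 1" using assms s by (intro mult_mono) auto
  then have "0 \<le> 1 - a * (1 - exp (- s))" by simp
  then have "(1 - a * (1 - exp (- s))) ^ (m - r) \<le> exp (- (a * u)) ^ (m - r)"
    using base by (intro power_mono)
  also have "\<dots> = exp (- (a * u) * (real m - real r))"
    using assms(5) by (simp add: exp_of_nat_mult[symmetric] of_nat_diff mult.commute)
  finally have "exp (s * ((a - \<epsilon>) * real m)) * (1 - a * (1 - exp (- s))) ^ (m - r)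
      \<le> exp (s * ((a - \<epsilon>) * real m)) * exp (- (a * u) * (real m - real r))"
    by (intro mult_left_mono) auto
  also have "\<dots> = exp (s * ((a - \<epsilon>) * real m) - (a * u) * (real m - real r))"
    by (simp add: exp_add[symmetric])
  also have "\<dots> \<le> exp (real r - \<epsilon>\<^sup>2 / 4 * real m)"
  proof -
    have 1: "a * u * real r \<le> 1 * real r" using u assms by (intro mult_right_mono mult_le_one) auto
    have 2: "a * (s\<^sup>2 * real m) \<le> 1 * (s\<^sup>2 * real m)" using assms by (intro mult_right_mono) auto
    have "s * ((a - \<epsilon>) * real m) - (a * u) * (real m - real r)
        = a * (s\<^sup>2 * real m) - 2 * (s\<^sup>2 * real m) + a * u * real r"
      unfolding u_def s(3) by (simp add: algebra_simps power2_eq_square)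
    also have "\<dots> \<le> real r - s\<^sup>2 * real m" using 1 2 by linarith
    also have "\<dots> = real r - \<epsilon>\<^sup>2 / 4 * real m" unfolding s(3) by (simp add: power2_eq_square)
    finally show ?thesis by simp
  qed
  also have "\<dots> = exp (real r) * exp (- (\<epsilon>\<^sup>2 / 4 * real m))" by (simp add: exp_add[symmetric])
  finally show ?thesis unfolding s_def .
qed

lemma power_times_exp_decay:
  fixes c :: real
  assumes "0 < c"
  shows "(\<lambda>m. real m ^ r * (exp (real r) * exp (- (c * real m)))) \<longlonglongrightarrow> 0"
proof -
  have "filterlim (\<lambda>m. c * real m) at_top sequentially"
    by (rule filterlim_tendsto_pos_mult_at_top[OF tendsto_const assms filterlim_real_sequentially])
  then have "(\<lambda>m. (c * real m) ^ r / exp (c * real m)) \<longlonglongrightarrow> 0"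
    by (rule filterlim_compose[OF tendsto_power_div_exp_0])
  then have "(\<lambda>m. (exp (real r) / c ^ r) * ((c * real m) ^ r / exp (c * real m))) \<longlonglongrightarrow> (exp (real r) / c ^ r) * 0"
    by (rule tendsto_mult_left)
  then show ?thesis using assms by (simp add: power_mult_distrib exp_minus field_simps)
qed

lemma ex_codegree_almost_decreasing:
  fixes F :: "'b hypergraph" and \<epsilon> :: real
  assumes F: "edges F \<noteq> {}" and \<epsilon>: "0 < \<epsilon>" "\<epsilon> \<le> 1"
  shows "\<exists>m0. \<forall>m\<ge>m0. \<exists>N0. \<forall>N\<ge>N0.
    real (ex_codegree k N F) / real N \<le> real (ex_codegree k m F) / real m + \<epsilon>"
proof -
  define r where "r = k - 1"
  have "0 < \<epsilon>\<^sup>2 / 4" using \<epsilon> by simp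
  from order_tendstoD(2)[OF power_times_exp_decay[OF this, of r], of "1 / 2"]
  obtain m1 where m1: "\<And>m. m1 \<le> m \<Longrightarrow> real m ^ r * (exp (real r) * exp (- (\<epsilon>\<^sup>2 / 4 * real m))) < 1 / 2"
    unfolding eventually_sequentially by auto
  show ?thesis
  proof (rule exI[of _ "max m1 (r + 1)"], intro allI impI)
    fix m assume "max m1 (r + 1) \<le> m"
    then have m: "m1 \<le> m" "r \<le> m" "0 < m" by auto
    \<comment> \<open>For \<open>N > 2 m\<^sup>2\<close> fewer than half of all samples have a repeated vertex.\<close>
    show "\<exists>N0. \<forall>N\<ge>N0. real (ex_codegree k N F) / real N \<le> real (ex_codegree k m F) / real m + \<epsilon>"
    proof (rule exI[of _ "2 * m ^ 2 + r + 1"], intro allI impI)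
      fix N assume N0: "2 * m ^ 2 + r + 1 \<le> N"
      then have N: "r \<le> N" "0 < N" by auto
      have "real (2 * m ^ 2) < real N" using N0 by (intro of_nat_less_iff[THEN iffD2]) simp
      then have collisions: "real m ^ 2 / real N < 1 / 2" using N(2) by (simp add: field_simps)
      define a where "a = real (ex_codegree k N F) / real N"
      have a01: "0 \<le> a" "a \<le> 1"
        using ex_codegree_le[OF F N(1)[unfolded r_def]] N(2) unfolding a_def by (simp_all add: divide_le_eq)
      have "real m ^ r * (exp (\<epsilon> / 2 * ((a - \<epsilon>) * real m)) * (1 - a * (1 - exp (- (\<epsilon> / 2)))) ^ (m - r))
          \<le> real m ^ r * (exp (real r) * exp (- (\<epsilon>\<^sup>2 / 4 * real m)))"
        using deficiency_bound[OF a01 \<epsilon> m(2)] by (intro mult_left_mono) auto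
      also have "\<dots> < 1 / 2" using m1[OF m(1)] .
      finally have "real m ^ 2 / real N + real m ^ r *
          (exp (\<epsilon> / 2 * ((a - \<epsilon>) * real m)) * (1 - a * (1 - exp (- (\<epsilon> / 2)))) ^ (m - r)) < 1"
        using collisions by linarith
      then have "(a - \<epsilon>) * real m \<le> real (ex_codegree k m F)"
        using ex_codegree_sampling[OF F m(2)[unfolded r_def] N(1)[unfolded r_def] N(2) _ a_def, of "\<epsilon> / 2"] \<epsilon>(1)
        unfolding r_def by simp
      then have "a - \<epsilon> \<le> real (ex_codegree k m F) / real m" using m(3) by (simp add: pos_le_divide_eq)
      then show "real (ex_codegree k N F) / real N \<le> real (ex_codegree k m F) / real m + \<epsilon>"
        unfolding a_def by linarith
    qed
  qed
qed

text \<open>The limit is the infimum of all eventual upper bounds: \<open>x m + \<epsilon>\<close> is such a bound for every large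
  \<open>m\<close>.\<close>
lemma convergent_if_almost_decreasing:
  fixes x :: "nat \<Rightarrow> real"
  assumes bounds: "\<And>n. 0 \<le> x n" "\<And>n. n0 \<le> n \<Longrightarrow> x n \<le> 1"
    and decr: "\<And>\<epsilon>. 0 < \<epsilon> \<Longrightarrow> \<epsilon> \<le> 1 \<Longrightarrow> \<exists>m0. \<forall>m\<ge>m0. \<exists>N0. \<forall>N\<ge>N0. x N \<le> x m + \<epsilon>"
  shows "convergent x"
proof -
  define C where "C = {c. \<exists>N0. \<forall>N\<ge>N0. x N \<le> c}"
  define L where "L = Inf C"
  have "1 \<in> C" unfolding C_def mem_Collect_eq using bounds(2) by (intro exI[of _ n0]) simp
  then have ne: "C \<noteq> {}" by blast
  have "0 \<le> c" if c: "c \<in> C" for c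
  proof -
    obtain N0 where "\<forall>N\<ge>N0. x N \<le> c" using c unfolding C_def by blast
    then have "x N0 \<le> c" by simp
    then show ?thesis using bounds(1)[of N0] by linarith
  qed
  then have below: "bdd_below C" by (meson bdd_belowI)
  have "x \<longlonglongrightarrow> L"
  proof (rule LIMSEQ_I)
    fix \<epsilon> :: real assume \<epsilon>: "0 < \<epsilon>"
    define \<delta> where "\<delta> = min (\<epsilon> / 2) 1"
    have \<delta>: "0 < \<delta>" "\<delta> \<le> 1" "\<delta> < \<epsilon>" using \<epsilon> unfolding \<delta>_def by auto
    have "Inf C < L + \<epsilon>" unfolding L_def using \<epsilon> by simp
    then obtain c where c: "c \<in> C" "c < L + \<epsilon>" using cInf_lessD[OF ne] by blast
    then obtain N1 where N1: "\<And>N. N1 \<le> N \<Longrightarrow> x N \<le> c" unfolding C_def by blast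
    obtain m0 where m0: "\<And>m. m0 \<le> m \<Longrightarrow> \<exists>N0. \<forall>N\<ge>N0. x N \<le> x m + \<delta>" using decr[OF \<delta>(1,2)] by blast
    show "\<exists>no. \<forall>n\<ge>no. norm (x n - L) < \<epsilon>"
    proof (rule exI[of _ "max N1 m0"], intro allI impI)
      fix n assume n: "max N1 m0 \<le> n"
      then have "x n + \<delta> \<in> C" unfolding C_def using m0[of n] by simp
      then have "L \<le> x n + \<delta>" unfolding L_def by (rule cInf_lower[OF _ below])
      moreover have "x n \<le> c" using N1[of n] n by simp
      ultimately show "norm (x n - L) < \<epsilon>" using c(2) \<delta>(3) by (simp add: abs_less_iff)
    qed
  qed
  then show ?thesis by (rule convergentI)
qed

theorem codegree_density_exists:
  fixes F :: "'b hypergraph"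
  assumes "edges F \<noteq> {}"
  shows "(\<lambda>n. real (ex_codegree k n F) / real n) \<longlonglongrightarrow> codegree_turan_density k F"
proof -
  have "convergent (\<lambda>n. real (ex_codegree k n F) / real n)"
  proof (rule convergent_if_almost_decreasing)
    show "real (ex_codegree k n F) / real n \<le> 1" if "k - 1 \<le> n" for n
      using ex_codegree_le[OF assms that] by (simp add: divide_le_eq)
    show "\<exists>m0. \<forall>m\<ge>m0. \<exists>N0. \<forall>N\<ge>N0. real (ex_codegree k N F) / real N \<le> real (ex_codegree k m F) / real m + \<epsilon>"
      if "0 < \<epsilon>" "\<epsilon> \<le> 1" for \<epsilon> by (rule ex_codegree_almost_decreasing[OF assms that])
  qed simp
  then show ?thesis unfolding codegree_turan_density_def by (simp add: convergent_LIMSEQ_iff)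
qed

section \<open>Hypergraphs given by a pattern of colour types\<close>

text \<open>A triple \<open>(a, b, c)\<close> of colour counts with sum \<open>k\<close> is represented by \<open>(b, c)\<close>; the first
  coordinate is recovered as \<open>k - (b + c)\<close>. Every \<open>h \<ge> 2\<close> denotes the last coordinate.\<close>
fun coord :: "nat \<Rightarrow> nat \<Rightarrow> nat \<times> nat \<Rightarrow> nat" where
  "coord k h (b, c) = (if h = 0 then k - (b + c) else if h = 1 then b else c)"

text \<open>The pair \<open>(b, c)\<close> with \<open>b + c < k\<close> in the first four conditions stands for the colour counts of a
  \<open>(k - 1)\<close>-set, and \<open>(b, c)\<close>, \<open>(Suc b, c)\<close>, \<open>(b, Suc c)\<close> are the types of its three
  possible completions. The first condition gives large codegree. The next three say that two
  adjacent points of \<open>T\<close> both carry as label the third colour, which is the one whose count they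
  share; so the label and its count are constant on connected parts of \<open>T\<close>. The last condition
  keeps this count away from the exceptional set \<open>B\<close>.\<close>
definition codegree_pattern :: "nat \<Rightarrow> nat set \<Rightarrow> (nat \<times> nat) set \<Rightarrow> (nat \<times> nat \<Rightarrow> nat) \<Rightarrow> bool" where
  "codegree_pattern k B T lab \<longleftrightarrow>
     (\<forall>b c. b + c < k \<longrightarrow> (b, c) \<in> T \<or> (Suc b, c) \<in> T \<or> (b, Suc c) \<in> T) \<and>
     (\<forall>b c. b + c < k \<longrightarrow> (b, c) \<in> T \<longrightarrow> (Suc b, c) \<in> T \<longrightarrow> lab (b, c) = 2 \<and> lab (Suc b, c) = 2) \<and>
     (\<forall>b c. b + c < k \<longrightarrow> (b, c) \<in> T \<longrightarrow> (b, Suc c) \<in> T \<longrightarrow> lab (b, c) = 1 \<and> lab (b, Suc c) = 1) \<and>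
     (\<forall>b c. b + c < k \<longrightarrow> (Suc b, c) \<in> T \<longrightarrow> (b, Suc c) \<in> T \<longrightarrow> lab (Suc b, c) = 0 \<and> lab (b, Suc c) = 0) \<and>
     (\<forall>b c. b + c \<le> k \<longrightarrow> (b, c) \<in> T \<longrightarrow> coord k (lab (b, c)) (b, c) \<notin> B)"

definition colour_count :: "nat \<Rightarrow> nat set \<Rightarrow> nat" where
  "colour_count h e = card {v \<in> e. v mod 3 = h}"

definition type_of :: "nat set \<Rightarrow> nat \<times> nat" where
  "type_of e = (colour_count 1 e, colour_count 2 e)"

definition pattern_graph :: "nat \<Rightarrow> (nat \<times> nat) set \<Rightarrow> nat \<Rightarrow> nat hypergraph" where
  "pattern_graph k T n =
     \<lparr>verts = {..<n}, edges = {e. e \<subseteq> {..<n} \<and> card e = k \<and> type_of e \<in> T}\<rparr>"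

lemma colour_count_insert:
  assumes "finite S" "v \<notin> S"
  shows "colour_count h (insert v S) = colour_count h S + (if v mod 3 = h then 1 else 0)"
proof -
  have "{w \<in> insert v S. w mod 3 = h} =
      (if v mod 3 = h then insert v {w \<in> S. w mod 3 = h} else {w \<in> S. w mod 3 = h})"
    by auto
  then show ?thesis using assms by (simp add: colour_count_def)
qed

lemma colour_count_sum:
  assumes "finite e"
  shows "colour_count 0 e + colour_count 1 e + colour_count 2 e = card e"
  using assms
proof (induction e)
  case (insert v S)
  have "v mod 3 = 0 \<or> v mod 3 = 1 \<or> v mod 3 = 2" by auto
  then show ?case using insert by (elim disjE) (simp_all add: colour_count_insert)
qed (simp add: colour_count_def)

lemma coord_type_of:
  assumes "finite e" "card e = k"
  shows "coord k h (type_of e) = colour_count (min h 2) e"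
proof -
  consider "h = 0" | "h = 1" | "2 \<le> h" by linarith
  then show ?thesis
    using colour_count_sum[OF assms(1)] assms(2) by cases (simp_all add: type_of_def)
qed

text \<open>Consecutive edges of a tight cycle are \<open>insert u S\<close> and \<open>insert v S\<close> with a common \<open>S\<close>. If \<open>u\<close> and
  \<open>v\<close> have different colours, then the label is the third colour, whose count does not change.\<close>
lemma label_constant_across_shared_set:
  assumes pat: "codegree_pattern k B T lab"
    and S: "finite S" "card S < k" and uv: "u \<notin> S" "v \<notin> S"
    and T: "type_of (insert u S) \<in> T" "type_of (insert v S) \<in> T"
  shows "lab (type_of (insert u S)) = lab (type_of (insert v S)) \<and>
    coord k (lab (type_of (insert u S))) (type_of (insert u S)) =
    coord k (lab (type_of (insert v S))) (type_of (insert v S))"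
proof -
  obtain b c where bc: "type_of S = (b, c)" by (cases "type_of S")
  have sum: "b + c < k" using colour_count_sum[OF S(1)] S(2) bc by (simp add: type_of_def)
  have ins: "type_of (insert w S) =
      (if w mod 3 = 0 then (b, c) else if w mod 3 = 1 then (Suc b, c) else (b, Suc c))" if "w \<notin> S" for w
  proof -
    have "w mod 3 = 0 \<or> w mod 3 = 1 \<or> w mod 3 = 2" by auto
    then show ?thesis using bc S(1) that by (elim disjE) (simp_all add: type_of_def colour_count_insert)
  qed
  have 1: "lab (b, c) = 2 \<and> lab (Suc b, c) = 2" if "(b, c) \<in> T" "(Suc b, c) \<in> T"
    using pat sum that unfolding codegree_pattern_def by blast
  have 2: "lab (b, c) = 1 \<and> lab (b, Suc c) = 1" if "(b, c) \<in> T" "(b, Suc c) \<in> T"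
    using pat sum that unfolding codegree_pattern_def by blast
  have 3: "lab (Suc b, c) = 0 \<and> lab (b, Suc c) = 0" if "(Suc b, c) \<in> T" "(b, Suc c) \<in> T"
    using pat sum that unfolding codegree_pattern_def by blast
  show ?thesis
    using T 1 2 3 unfolding ins[OF uv(1)] ins[OF uv(2)] by (simp split: if_splits)
qed

lemma card_residue_class:
  assumes "h < 3"
  shows "n div 3 \<le> card {v \<in> {..<n}. v mod 3 = h}"
proof -
  have "card ((\<lambda>t. 3 * t + h) ` {..<n div 3}) \<le> card {v \<in> {..<n}. v mod 3 = h}"
    using assms by (intro card_mono) auto
  moreover have "card ((\<lambda>t. 3 * t + h) ` {..<n div 3}) = n div 3"
    by (subst card_image) (auto simp: inj_on_def)
  ultimately show ?thesis by simp
qed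

lemma pattern_graph_uniform: "uniform_hypergraph k (pattern_graph k T n)"
  by (auto simp: uniform_hypergraph_def pattern_graph_def)

lemma codegree_pattern_graph:
  assumes pat: "codegree_pattern k B T lab" and "0 < k"
    and S: "S \<subseteq> {..<n}" "card S = k - 1"
  shows "n div 3 \<le> codegree (pattern_graph k T n) S + k"
proof -
  have fin: "finite S" using S finite_subset by blast
  obtain b c where bc: "type_of S = (b, c)" by (cases "type_of S")
  have sum: "b + c < k" using colour_count_sum[OF fin] S(2) bc assms(2) by (simp add: type_of_def)
  have "(b, c) \<in> T \<or> (Suc b, c) \<in> T \<or> (b, Suc c) \<in> T"
    using pat sum unfolding codegree_pattern_def by blast
  then have "\<exists>h<3::nat. (if h = 0 then (b, c) else if h = 1 then (Suc b, c) else (b, Suc c)) \<in> T"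
  proof (elim disjE)
    show "\<exists>h<3::nat. (if h = 0 then (b, c) else if h = 1 then (Suc b, c) else (b, Suc c)) \<in> T" if "(b, c) \<in> T" using that by (intro exI[of _ 0]) simp
    show "\<exists>h<3::nat. (if h = 0 then (b, c) else if h = 1 then (Suc b, c) else (b, Suc c)) \<in> T" if "(Suc b, c) \<in> T" using that by (intro exI[of _ 1]) simp
    show "\<exists>h<3::nat. (if h = 0 then (b, c) else if h = 1 then (Suc b, c) else (b, Suc c)) \<in> T" if "(b, Suc c) \<in> T" using that by (intro exI[of _ 2]) simp
  qed
  then obtain h :: nat where h: "h < 3"
    "(if h = 0 then (b, c) else if h = 1 then (Suc b, c) else (b, Suc c)) \<in> T" by blast
  have "{v \<in> {..<n}. v mod 3 = h} - S \<subseteq> {v \<in> verts (pattern_graph k T n). S \<union> {v} \<in> edges (pattern_graph k T n)}"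
  proof
    fix v assume v: "v \<in> {v \<in> {..<n}. v mod 3 = h} - S"
    then have "type_of (insert v S) = (if h = 0 then (b, c) else if h = 1 then (Suc b, c) else (b, Suc c))"
      using bc fin h(1) by (auto simp: type_of_def colour_count_insert)
    then have "type_of (insert v S) \<in> T" using h(2) by simp
    moreover have "card (insert v S) = k" using v fin S(2) assms(2) by simp
    ultimately show "v \<in> {v \<in> verts (pattern_graph k T n). S \<union> {v} \<in> edges (pattern_graph k T n)}"
      using v S(1) by (simp add: pattern_graph_def)
  qed
  then have "card ({v \<in> {..<n}. v mod 3 = h} - S) \<le> codegree (pattern_graph k T n) S"
    unfolding codegree_def by (intro card_mono) (simp_all add: pattern_graph_def)
  moreover have "card {v \<in> {..<n}. v mod 3 = h} \<le> card ({v \<in> {..<n}. v mod 3 = h} - S) + card S"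
    using diff_card_le_card_Diff[OF fin, of "{v \<in> {..<n}. v mod 3 = h}"] by linarith
  ultimately show ?thesis using card_residue_class[OF h(1), of n] S(2) by linarith
qed

lemma min_codegree_pattern_graph:
  assumes "codegree_pattern k B T lab" "0 < k" "k \<le> n"
  shows "n div 3 \<le> min_codegree k (pattern_graph k T n) + k"
proof -
  let ?K = "{S. S \<subseteq> verts (pattern_graph k T n) \<and> card S = k - 1}"
  have V: "verts (pattern_graph k T n) = {..<n}" by (simp add: pattern_graph_def)
  have "finite ?K" unfolding V by simp
  moreover have "{..<k - 1} \<in> ?K" unfolding V using assms(3) by auto
  then have "codegree (pattern_graph k T n) ` ?K \<noteq> {}" by blast
  ultimately have "min_codegree k (pattern_graph k T n) \<in> codegree (pattern_graph k T n) ` ?K"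
    unfolding min_codegree_def by (intro Min_in finite_imageI)
  then show ?thesis using codegree_pattern_graph[OF assms(1,2)] unfolding V by auto
qed

lemma mod_shift_inj:
  fixes a b l t :: nat
  assumes "a < l" "b < l"
  shows "(t + a) mod l = (t + b) mod l \<longleftrightarrow> a = b"
  using assms cong_add_lcancel_nat[of t a b l] cong_less_modulus_unique_nat[of a b l]
  unfolding cong_def by auto

definition window :: "nat \<Rightarrow> nat \<Rightarrow> nat \<Rightarrow> nat set" where
  "window k l t = (\<lambda>j. (t + j) mod l) ` {..<k}"

lemma edges_tight_cycle: "edges (tight_cycle k l) = window k l ` {..<l}"
  by (simp add: tight_cycle_def window_def)

lemma window_mod: "window k l (t mod l) = window k l t"
  by (simp add: window_def mod_simps)

lemma mem_window_iff:
  assumes "a < l" "k \<le> l"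
  shows "(t + a) mod l \<in> window k l t \<longleftrightarrow> a < k"
proof -
  have "(t + a) mod l = (t + j) mod l \<longleftrightarrow> a = j" if "j < k" for j
    using mod_shift_inj[of a l j t] assms that by simp
  then show ?thesis unfolding window_def image_iff by auto
qed

lemma window_inj:
  assumes "0 < s" "s < l" "k < l" "0 < k"
  shows "window k l (t + s) \<noteq> window k l t"
proof
  assume eq: "window k l (t + s) = window k l t"
  have "(t + s + 0) mod l \<in> window k l (t + s)"
    using assms by (subst mem_window_iff) auto
  then have "s < k" using mem_window_iff[of s l k t] assms eq by simp
  then have "(t + (s - 1)) mod l \<in> window k l (t + s)"
    using assms unfolding eq by (subst mem_window_iff) auto
  moreover have "(t + s + (l - 1)) mod l = (t + (s - 1)) mod l"
  proof -
    have "t + s + (l - 1) = t + (s - 1) + l" using assms by simp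
    then show ?thesis by (simp only: mod_add_self2)
  qed
  ultimately have "(t + s + (l - 1)) mod l \<in> window k l (t + s)" by simp
  then show False using assms mem_window_iff[of "l - 1" l k "t + s"] by simp
qed

lemma sum_shift_mod:
  fixes g :: "nat \<Rightarrow> nat"
  assumes "0 < l"
  shows "(\<Sum>t<l. g ((j + t) mod l)) = (\<Sum>i<l. g i)"
proof (rule sum.reindex_bij_betw)
  have inj: "inj_on (\<lambda>t. (j + t) mod l) {..<l}"
    by (rule inj_onI) (simp add: mod_shift_inj)
  moreover have "(\<lambda>t. (j + t) mod l) ` {..<l} = {..<l}"
    using assms by (intro endo_inj_surj inj) auto
  ultimately show "bij_betw (\<lambda>t. (j + t) mod l) {..<l} {..<l}"
    unfolding bij_betw_def by simp
qed

text \<open>Double counting: every position lies in exactly \<open>k\<close> of the \<open>l\<close> cyclic windows.\<close>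
lemma sum_window_counts:
  fixes \<chi> :: "nat \<Rightarrow> bool"
  assumes "0 < l" "k \<le> l"
  shows "(\<Sum>t<l. card {i \<in> window k l t. \<chi> i}) = k * card {i \<in> {..<l}. \<chi> i}"
proof -
  have count: "card {i \<in> window k l t. \<chi> i} = (\<Sum>j<k. if \<chi> ((t + j) mod l) then 1 else 0)" for t
  proof -
    have inj: "inj_on (\<lambda>j. (t + j) mod l) {..<k}"
      using assms by (auto intro!: inj_onI simp: mod_shift_inj)
    have "card {i \<in> window k l t. \<chi> i} = (\<Sum>i\<in>window k l t. if \<chi> i then 1 else 0)"
      by (simp add: sum.If_cases window_def Int_def)
    also have "\<dots> = (\<Sum>j<k. if \<chi> ((t + j) mod l) then 1 else 0)"
      unfolding window_def by (simp add: sum.reindex[OF inj])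
    finally show ?thesis .
  qed
  have "(\<Sum>t<l. card {i \<in> window k l t. \<chi> i}) = (\<Sum>j<k. \<Sum>t<l. if \<chi> ((j + t) mod l) then 1 else 0)"
    unfolding count by (subst sum.swap) (simp add: add.commute)
  also have "\<dots> = (\<Sum>j<k. \<Sum>i<l. if \<chi> i then 1 else 0)"
    using sum_shift_mod[OF assms(1), of "\<lambda>i. if \<chi> i then 1 else 0"] by simp
  also have "\<dots> = k * card {i \<in> {..<l}. \<chi> i}"
    by (simp add: sum.If_cases Int_def)
  finally show ?thesis .
qed

lemma card_filter_insert_le:
  assumes "finite S"
  shows "card {i \<in> insert u S. P i} \<le> card {i \<in> insert v S. P i} + 1"
proof -
  have "card {i \<in> insert u S. P i} \<le> card (insert u {i \<in> S. P i})"
    using assms by (intro card_mono) auto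
  also have "\<dots> \<le> card {i \<in> S. P i} + 1" using assms by (simp add: card_insert_if)
  also have "\<dots> \<le> card {i \<in> insert v S. P i} + 1"
    using assms by (intro add_right_mono card_mono) auto
  finally show ?thesis .
qed

lemma window_consecutive:
  assumes "0 < k" "k < l"
  obtains R where "R \<subseteq> {..<l}" "card R = k - 1" "t mod l \<notin> R" "(t + k) mod l \<notin> R"
    "window k l t = insert (t mod l) R" "window k l (Suc t) = insert ((t + k) mod l) R"
proof
  define R where "R = (\<lambda>j. (t + j) mod l) ` {0<..<k}"
  have inj: "(t + a) mod l = (t + b) mod l \<longleftrightarrow> a = b" if "a \<le> k" "b \<le> k" for a b
    using that assms by (simp add: mod_shift_inj)
  show "R \<subseteq> {..<l}" using assms unfolding R_def by auto
  have "inj_on (\<lambda>j. (t + j) mod l) {0<..<k}" by (rule inj_onI) (simp add: inj)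
  then show "card R = k - 1" unfolding R_def by (simp add: card_image)
  have "t mod l \<noteq> (t + j) mod l" "(t + k) mod l \<noteq> (t + j) mod l" if "j \<in> {0<..<k}" for j
    using inj[of 0 j] inj[of k j] that by auto
  then show "t mod l \<notin> R" "(t + k) mod l \<notin> R" unfolding R_def by blast+
  have "{..<k} = insert 0 {0<..<k}" using assms by auto
  then show "window k l t = insert (t mod l) R" unfolding window_def R_def by simp
  have "Suc ` {..<k} = insert k {0<..<k}"
  proof -
    have "Suc ` {..<k} = {0<..k}" by (metis atLeast0LessThan atLeastSucAtMost_greaterThanAtMost image_Suc_atLeastLessThan atLeastLessThanSuc_atLeastAtMost)
    also have "\<dots> = insert k {0<..<k}" using assms by auto
    finally show ?thesis .
  qed
  then have "window k l (Suc t) = (\<lambda>j. (t + j) mod l) ` insert k {0<..<k}"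
    unfolding window_def by (metis (no_types, lifting) add_Suc_shift image_cong image_image)
  then show "window k l (Suc t) = insert ((t + k) mod l) R" unfolding R_def by simp
qed

text \<open>The window at \<open>t\<close> is the one whose edge is missing. It shares \<open>k - 1\<close> positions with its successor, so
  its count is \<open>m\<close> up to one, and the sum over all windows is a multiple of \<open>k\<close>.\<close>
lemma almost_constant_window_count:
  fixes \<chi> :: "nat \<Rightarrow> bool"
  assumes "0 < k" "k < l"
    and const: "\<And>s. 0 < s \<Longrightarrow> s < l \<Longrightarrow> card {i \<in> window k l (t + s). \<chi> i} = m"
  shows "\<exists>d\<in>{-1, 0, 1}. [int l * int m = d] (mod int k)"
proof -
  let ?M = "\<lambda>t. card {i \<in> window k l t. \<chi> i}"
  have Mt: "?M (t + 0) \<le> m + 1" "m \<le> ?M (t + 0) + 1"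
  proof -
    obtain R where R: "R \<subseteq> {..<l}"
      "window k l t = insert (t mod l) R" "window k l (Suc t) = insert ((t + k) mod l) R"
      using window_consecutive[OF assms(1,2)] by metis
    have fin: "finite R" using R(1) finite_subset by blast
    have m: "?M (Suc t) = m" using const[of 1] assms by simp
    show "?M (t + 0) \<le> m + 1" unfolding m[symmetric] add_0_right R(2,3) by (rule card_filter_insert_le[OF fin])
    show "m \<le> ?M (t + 0) + 1" unfolding m[symmetric] add_0_right R(2,3) by (rule card_filter_insert_le[OF fin])
  qed
  have "k * card {i \<in> {..<l}. \<chi> i} = (\<Sum>i<l. ?M i)"
    using sum_window_counts[of l k \<chi>] assms by simp
  also have "\<dots> = (\<Sum>s<l. ?M ((t + s) mod l))"
    using sum_shift_mod[of l ?M t] assms by simp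
  also have "\<dots> = (\<Sum>s<l. ?M (t + s))" by (simp only: window_mod)
  also have "\<dots> = ?M (t + 0) + (\<Sum>s\<in>{0<..<l}. ?M (t + s))"
  proof -
    have "{..<l} = insert 0 {0<..<l}" using assms by auto
    then show ?thesis by simp
  qed
  also have "(\<Sum>s\<in>{0<..<l}. ?M (t + s)) = (\<Sum>s\<in>{0<..<l}. m)" using const by (intro sum.cong) auto
  also have "\<dots> = (l - 1) * m" by simp
  finally have "k * card {i \<in> {..<l}. \<chi> i} = ?M (t + 0) + (l - 1) * m" .
  then have "int k * int (card {i \<in> {..<l}. \<chi> i}) = int (?M (t + 0)) + int (l - 1) * int m"
    by (metis of_nat_add of_nat_mult)
  then have "int l * int m - (int m - int (?M (t + 0))) = int k * int (card {i \<in> {..<l}. \<chi> i})"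
    using assms by (simp add: of_nat_diff algebra_simps)
  then have "[int l * int m = int m - int (?M (t + 0))] (mod int k)"
    unfolding cong_iff_dvd_diff by simp
  moreover have "int m - int (?M (t + 0)) \<in> {-1, 0, 1}" using Mt by auto
  ultimately show ?thesis by blast
qed

text \<open>Following the present windows once around the cycle, the label and its count never change. The
  common count then solves a congruence all of whose solutions lie in \<open>B\<close>.\<close>
lemma pattern_graph_free:
  assumes pat: "codegree_pattern k B T lab" and kl: "2 \<le> k" "k < l"
    and B: "\<And>m d. m \<le> k \<Longrightarrow> d \<in> {-1, 0, 1} \<Longrightarrow> [int l * int m = d] (mod int k) \<Longrightarrow> m \<in> B"
    and e: "e \<in> edges (tight_cycle k l)"
  shows "\<not> contains_copy (pattern_graph k T n) (remove_edge (tight_cycle k l) e)"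
proof
  assume "contains_copy (pattern_graph k T n) (remove_edge (tight_cycle k l) e)"
  then obtain f where f: "inj_on f {..<l}"
    "\<And>w. w \<in> edges (tight_cycle k l) \<Longrightarrow> w \<noteq> e \<Longrightarrow> f ` w \<in> edges (pattern_graph k T n)"
    unfolding contains_copy_def by (auto simp: remove_edge_def tight_cycle_def)
  obtain t where t: "t < l" "e = window k l t" using e unfolding edges_tight_cycle by auto
  let ?W = "\<lambda>s. window k l (t + s)"
  let ?y = "\<lambda>s. type_of (f ` ?W s)"
  have edge: "f ` ?W s \<in> edges (pattern_graph k T n)" if "0 < s" "s < l" for s
  proof (rule f(2))
    have "?W s = window k l ((t + s) mod l)" by (simp only: window_mod)
    then show "?W s \<in> edges (tight_cycle k l)" unfolding edges_tight_cycle using kl by auto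
    show "?W s \<noteq> e" unfolding t(2) using that kl by (intro window_inj) auto
  qed
  have edge': "finite (f ` ?W s)" "card (f ` ?W s) = k" "?y s \<in> T" if "0 < s" "s < l" for s
    using edge[OF that] by (auto simp: pattern_graph_def intro: finite_subset)
  define h where "h = lab (?y 1)"
  define m where "m = coord k h (?y 1)"
  have const: "lab (?y (Suc s)) = h \<and> coord k h (?y (Suc s)) = m" if "Suc s < l" for s
    using that
  proof (induction s)
    case 0
    then show ?case by (simp add: h_def m_def)
  next
    case (Suc s)
    obtain R where R: "R \<subseteq> {..<l}" "card R = k - 1" "(t + Suc s) mod l \<notin> R" "(t + Suc s + k) mod l \<notin> R"
      "?W (Suc s) = insert ((t + Suc s) mod l) R" "?W (Suc (Suc s)) = insert ((t + Suc s + k) mod l) R"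
      using window_consecutive[of k l "t + Suc s"] kl by auto
    have out: "f v \<notin> f ` R" if "v < l" "v \<notin> R" for v
      using that R(1) f(1) by (auto simp: inj_on_def)
    have "card (f ` R) \<le> card R" using R(1) finite_subset by (intro card_image_le) auto
    then have card: "card (f ` R) < k" using R(2) kl by linarith
    have fin: "finite (f ` R)" using R(1) finite_subset by blast
    have img: "f ` ?W (Suc s) = insert (f ((t + Suc s) mod l)) (f ` R)"
      "f ` ?W (Suc (Suc s)) = insert (f ((t + Suc s + k) mod l)) (f ` R)"
      unfolding R(5,6) by simp_all
    have IH: "lab (?y (Suc s)) = h" "coord k h (?y (Suc s)) = m" using Suc by simp_all
    have step: "lab (?y (Suc s)) = lab (?y (Suc (Suc s))) \<and>
        coord k (lab (?y (Suc s))) (?y (Suc s)) = coord k (lab (?y (Suc (Suc s)))) (?y (Suc (Suc s)))"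
      unfolding img
      by (rule label_constant_across_shared_set[OF pat fin card out out])
        (use R(3,4) kl edge'(3)[of "Suc s"] edge'(3)[of "Suc (Suc s)"] Suc.prems in \<open>simp_all only: img mod_less_divisor, auto\<close>)
    have "lab (?y (Suc (Suc s))) = h" using step[THEN conjunct1] unfolding IH(1) by (rule sym)
    moreover from this have "coord k h (?y (Suc (Suc s))) = m"
      using step[THEN conjunct2] unfolding IH(1) IH(2) by (simp only:)
    ultimately show ?case by (rule conjI)
  qed
  have "card {i \<in> ?W s. f i mod 3 = min h 2} = m" if s: "0 < s" "s < l" for s
  proof -
    have "m = coord k h (?y s)" using const[of "s - 1"] s by simp
    also have "\<dots> = colour_count (min h 2) (f ` ?W s)" using edge'(1,2)[OF s] by (rule coord_type_of)
    also have "\<dots> = card (f ` {i \<in> ?W s. f i mod 3 = min h 2})"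
      unfolding colour_count_def by (rule arg_cong[of _ _ card]) auto
    also have "\<dots> = card {i \<in> ?W s. f i mod 3 = min h 2}"
    proof (rule card_image, rule inj_on_subset[OF f(1)])
      show "{i \<in> ?W s. f i mod 3 = min h 2} \<subseteq> {..<l}" using kl by (auto simp: window_def)
    qed
    finally show ?thesis by simp
  qed
  then have "\<exists>d\<in>{-1, 0, 1}. [int l * int m = d] (mod int k)"
    using kl by (intro almost_constant_window_count[where \<chi> = "\<lambda>i. f i mod 3 = min h 2" and t = t]) auto
  moreover have "m \<le> k \<and> m \<notin> B"
  proof -
    have one: "(0::nat) < 1" "1 < l" using kl by auto
    obtain b c where bc: "?y 1 = (b, c)" by (cases "?y 1")
    have "b + c \<le> k" using colour_count_sum[OF edge'(1)[OF one]] edge'(2)[OF one] bc by (simp add: type_of_def)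
    moreover have "(b, c) \<in> T" using edge'(3)[OF one] bc by simp
    ultimately have "coord k (lab (b, c)) (b, c) \<notin> B" "coord k (lab (b, c)) (b, c) \<le> k"
      using pat unfolding codegree_pattern_def by auto
    then show ?thesis unfolding m_def h_def bc by blast
  qed
  ultimately show False using B by blast
qed

section \<open>Patterns avoiding the exceptional counts\<close>

definition colour_lattice :: "(nat \<times> nat) set" where
  "colour_lattice = {(b, c). b mod 3 = c mod 3}"

lemma mem_colour_lattice [simp]: "(b, c) \<in> colour_lattice \<longleftrightarrow> b mod 3 = c mod 3"
  by (simp add: colour_lattice_def)

lemma lattice_apart:
  "b mod 3 \<noteq> c mod (3::nat) \<or> Suc b mod 3 \<noteq> c mod (3::nat)"
  "b mod 3 \<noteq> c mod (3::nat) \<or> b mod 3 \<noteq> Suc c mod (3::nat)"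
  "Suc b mod 3 \<noteq> c mod (3::nat) \<or> b mod 3 \<noteq> Suc c mod (3::nat)"
  by (auto simp: mod_Suc)

lemma lattice_exhaustive:
  "b mod 3 = c mod 3 \<or> Suc b mod 3 = c mod 3 \<or> b mod 3 = Suc c mod (3::nat)"
proof -
  have "b mod 3 \<in> {0, 1, 2}" "c mod 3 \<in> {0, 1, 2}" by auto
  then show ?thesis by (auto simp: mod_Suc)
qed

lemma three_dvd_add_iff:
  "3 dvd p + q \<longleftrightarrow> (p mod 3, q mod 3) \<in> {(0, 0), (1, 2), (2, 1 :: nat)}"
proof -
  have "p mod 3 \<in> {0, 1, 2}" "q mod 3 \<in> {0, 1, 2}" by auto
  moreover have "3 dvd p + q \<longleftrightarrow> (p mod 3 + q mod 3) mod 3 = 0"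
    by (simp only: dvd_eq_mod_eq_0 mod_add_eq)
  ultimately show ?thesis by (elim insertE emptyE; simp)
qed

text \<open>No two lattice points are adjacent, so every adjacency of a modified lattice involves one
  of the added points.\<close>
lemma adjacent_in_modified_lattice:
  assumes "T \<subseteq> colour_lattice \<union> N"
  shows "(b, c) \<in> T \<Longrightarrow> (Suc b, c) \<in> T \<Longrightarrow> (b, c) \<in> N \<or> (Suc b, c) \<in> N"
    and "(b, c) \<in> T \<Longrightarrow> (b, Suc c) \<in> T \<Longrightarrow> (b, c) \<in> N \<or> (b, Suc c) \<in> N"
    and "(Suc b, c) \<in> T \<Longrightarrow> (b, Suc c) \<in> T \<Longrightarrow> (Suc b, c) \<in> N \<or> (b, Suc c) \<in> N"
  using assms lattice_apart[of b c] mem_colour_lattice by blast+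

text \<open>The lattice meets every triangle of completions exactly once, so only the triangles that were met in a
  removed point have to be inspected.\<close>
lemma modified_lattice_meets_triangles:
  assumes "b + c < k"
    and "\<And>b c. (b, c) \<in> R \<Longrightarrow> b + c < k \<Longrightarrow> (Suc b, c) \<in> N \<or> (b, Suc c) \<in> N"
    and "\<And>b c. (Suc b, c) \<in> R \<Longrightarrow> b + c < k \<Longrightarrow> (b, c) \<in> N \<or> (b, Suc c) \<in> N"
    and "\<And>b c. (b, Suc c) \<in> R \<Longrightarrow> b + c < k \<Longrightarrow> (b, c) \<in> N \<or> (Suc b, c) \<in> N"
  shows "(b, c) \<in> (colour_lattice - R) \<union> N \<or> (Suc b, c) \<in> (colour_lattice - R) \<union> N \<or> (b, Suc c) \<in> (colour_lattice - R) \<union> N"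
  using lattice_exhaustive[of b c] assms unfolding mem_colour_lattice[symmetric] by blast

text \<open>The bad points: up to permuting coordinates, they are the corners and the points with coordinates \<open>p\<close>,
  \<open>q\<close>, \<open>0\<close>. The inequalities exclude coincidences such as \<open>3 p = p + q\<close>.\<close>
lemma exceptional_types:
  fixes p q :: nat
  assumes "a \<in> {0, p, q, p + q}" "b \<in> {0, p, q, p + q}" "c \<in> {0, p, q, p + q}"
    and "a + b + c = p + q" "2 \<le> p" "2 \<le> q" "p \<noteq> q" "p \<noteq> 2 * q" "q \<noteq> 2 * p"
  shows "(b, c) \<in> {(0, 0), (p + q, 0), (0, p + q), (p, q), (q, p), (p, 0), (q, 0), (0, p), (0, q)}"
proof -
  have "\<not> (b = p \<and> c = p)" "\<not> (b = q \<and> c = q)"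
    using assms(1,4-) by auto
  moreover have "b + c \<le> p + q" using assms(4) by linarith
  ultimately show ?thesis using assms(2,3,5,6) by (elim insertE emptyE; simp)
qed

text \<open>For a point without neighbours in the pattern the label is not tied to anything else, so it may be any colour
  whose count lies outside \<open>B\<close>.\<close>
fun free_coord :: "nat \<Rightarrow> nat set \<Rightarrow> nat \<times> nat \<Rightarrow> nat" where
  "free_coord k B (b, c) = (if k - (b + c) \<notin> B then 0 else if b \<notin> B then 1 else 2)"

lemma free_coord_unexceptional:
  fixes p q :: nat
  defines "B \<equiv> {0, p, q, p + q}"
  assumes "b + c \<le> p + q" "2 \<le> p" "2 \<le> q" "p \<noteq> q" "p \<noteq> 2 * q" "q \<noteq> 2 * p"
    and "(b, c) \<notin> {(0, 0), (p + q, 0), (0, p + q), (p, q), (q, p), (p, 0), (q, 0), (0, p), (0, q)}"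
  shows "coord (p + q) (free_coord (p + q) B (b, c)) (b, c) \<notin> B"
proof (rule ccontr)
  assume "\<not> ?thesis"
  then have *: "p + q - (b + c) \<in> B" "b \<in> B" "c \<in> B"
    by (simp_all split: if_splits)
  have "p + q - (b + c) + b + c = p + q" using assms(2) by simp
  from exceptional_types[OF *[unfolded B_def] this assms(3-7)] assms(8) show False by contradiction
qed

text \<open>If \<open>3\<close> divides \<open>k\<close>, then the bad lattice points are the three corners. Each is moved one step
  towards the next corner, cyclically.\<close>
definition corners_moved :: "nat \<Rightarrow> (nat \<times> nat) set" where
  "corners_moved k = {(1, 0), (k - 1, 1), (0, k - 1)}"

definition corners_pattern :: "nat \<Rightarrow> (nat \<times> nat) set" where
  "corners_pattern k = (colour_lattice - {(0, 0), (k, 0), (0, k)}) \<union> corners_moved k"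

lemma corners_adjacent:
  assumes k: "3 dvd k" "6 \<le> k" "b + c < k"
  shows "(b, c) \<in> corners_pattern k \<Longrightarrow> (Suc b, c) \<in> corners_pattern k \<Longrightarrow> b + 2 = k \<and> c = 1" (is "?a \<Longrightarrow> ?b \<Longrightarrow> _")
    and "(b, c) \<in> corners_pattern k \<Longrightarrow> (b, Suc c) \<in> corners_pattern k \<Longrightarrow> b = 1 \<and> c = 0" (is "_ \<Longrightarrow> ?c \<Longrightarrow> _")
    and "(Suc b, c) \<in> corners_pattern k \<Longrightarrow> (b, Suc c) \<in> corners_pattern k \<Longrightarrow> b = 0 \<and> c + 2 = k"
proof -
  obtain u where "k = 3 * u" using k(1) by (rule dvdE)
  then obtain t where t: "k = Suc (Suc (Suc (3 * t)))" "t > 0"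
    using k(2) that[of "u - 1"] by auto
  have sub: "corners_pattern k \<subseteq> colour_lattice \<union> corners_moved k" unfolding corners_pattern_def by blast
  note elims = corners_moved_def insert_iff prod.inject empty_iff HOL.simp_thms
  note [simp] = t(1) corners_pattern_def corners_moved_def mod_Suc
  show "b + 2 = k \<and> c = 1" if 1: ?a and 2: ?b
    using adjacent_in_modified_lattice(1)[OF sub 1 2] unfolding elims
    using that k(3) t(2) by (elim disjE conjE; simp)
  show "b = 1 \<and> c = 0" if 1: ?a and 2: ?c
    using adjacent_in_modified_lattice(2)[OF sub 1 2] unfolding elims
    using that k(3) t(2) by (elim disjE conjE; simp)
  show "b = 0 \<and> c + 2 = k" if 1: ?b and 2: ?c
    using adjacent_in_modified_lattice(3)[OF sub 1 2] unfolding elims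
    using that k(3) t(2) by (elim disjE conjE; simp)
qed

lemma corners_meets_triangles:
  assumes "b + c < k"
  shows "(b, c) \<in> corners_pattern k \<or> (Suc b, c) \<in> corners_pattern k \<or> (b, Suc c) \<in> corners_pattern k"
  unfolding corners_pattern_def by (rule modified_lattice_meets_triangles[of b c k, OF assms]; elim insertE emptyE; clarsimp simp: corners_moved_def)

text \<open>If \<open>3\<close> divides \<open>p\<close> but not \<open>k\<close>, then the bad lattice points are the corner \<open>(k, 0, 0)\<close> and the points
  \<open>(q, p, 0)\<close> and \<open>(q, 0, p)\<close> on the two sides that meet there.\<close>
definition two_sides_moved :: "nat \<Rightarrow> (nat \<times> nat) set" where
  "two_sides_moved p = {(1, 0), (p - 1, 0), (p + 1, 0), (0, p - 1), (0, p + 1)}"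

definition two_sides_pattern :: "nat \<Rightarrow> (nat \<times> nat) set" where
  "two_sides_pattern p = (colour_lattice - {(0, 0), (p, 0), (0, p)}) \<union> two_sides_moved p"

lemma two_sides_adjacent:
  assumes p: "3 dvd p" "6 \<le> p"
  shows "(b, c) \<in> two_sides_pattern p \<Longrightarrow> (Suc b, c) \<in> two_sides_pattern p \<Longrightarrow> b = 0 \<and> c = p + 1" (is "?a \<Longrightarrow> ?b \<Longrightarrow> _")
    and "(b, c) \<in> two_sides_pattern p \<Longrightarrow> (b, Suc c) \<in> two_sides_pattern p \<Longrightarrow> (b = 1 \<or> b = p + 1) \<and> c = 0" (is "_ \<Longrightarrow> ?c \<Longrightarrow> _")
    and "(Suc b, c) \<in> two_sides_pattern p \<Longrightarrow> (b, Suc c) \<in> two_sides_pattern p \<Longrightarrow> b + c + 2 = p \<and> (b = 0 \<or> c = 0)"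
proof -
  obtain u where "p = 3 * u" using p(1) by (rule dvdE)
  then obtain t where t: "p = Suc (Suc (Suc (3 * t)))" "t > 0"
    using p(2) that[of "u - 1"] by auto
  have sub: "two_sides_pattern p \<subseteq> colour_lattice \<union> two_sides_moved p" unfolding two_sides_pattern_def by blast
  note elims = two_sides_moved_def insert_iff prod.inject empty_iff HOL.simp_thms
  note [simp] = t(1) two_sides_pattern_def two_sides_moved_def mod_Suc
  show "b = 0 \<and> c = p + 1" if 1: ?a and 2: ?b
    using adjacent_in_modified_lattice(1)[OF sub 1 2] unfolding elims
    using that t(2) by (elim disjE conjE; simp)
  show "(b = 1 \<or> b = p + 1) \<and> c = 0" if 1: ?a and 2: ?c
    using adjacent_in_modified_lattice(2)[OF sub 1 2] unfolding elims
    using that t(2) by (elim disjE conjE; simp)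
  show "b + c + 2 = p \<and> (b = 0 \<or> c = 0)" if 1: ?b and 2: ?c
    using adjacent_in_modified_lattice(3)[OF sub 1 2] unfolding elims
    using that t(2) by (elim disjE conjE; simp)
qed

lemma two_sides_meets_triangles: "(b, c) \<in> two_sides_pattern p \<or> (Suc b, c) \<in> two_sides_pattern p \<or> (b, Suc c) \<in> two_sides_pattern p"
  unfolding two_sides_pattern_def by (rule modified_lattice_meets_triangles[of b c "b + c + 1", OF less_add_one]; elim insertE emptyE; clarsimp simp: two_sides_moved_def)

text \<open>If \<open>p \<equiv> q\<close> are not divisible by \<open>3\<close>, then the bad lattice points are the corner \<open>(k, 0, 0)\<close> and the
  points \<open>(0, p, q)\<close> and \<open>(0, q, p)\<close> on the opposite side.\<close>
definition one_side_moved :: "nat \<Rightarrow> nat \<Rightarrow> (nat \<times> nat) set" where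
  "one_side_moved p q = {(1, 0), (p - 1, q + 1), (p + 1, q - 1), (q - 1, p + 1), (q + 1, p - 1)}"

definition one_side_pattern :: "nat \<Rightarrow> nat \<Rightarrow> (nat \<times> nat) set" where
  "one_side_pattern p q = (colour_lattice - {(0, 0), (p, q), (q, p)}) \<union> one_side_moved p q"

lemma one_side_adjacent:
  assumes pq: "p mod 3 = q mod 3" "2 \<le> p" "p + 6 \<le> q" "b + c < p + q"
  shows "(b, c) \<in> one_side_pattern p q \<Longrightarrow> (Suc b, c) \<in> one_side_pattern p q \<Longrightarrow> b + 2 = p \<and> c = q + 1 \<or> b + 2 = q \<and> c = p + 1"
      (is "?a \<Longrightarrow> ?b \<Longrightarrow> _")
    and "(b, c) \<in> one_side_pattern p q \<Longrightarrow> (b, Suc c) \<in> one_side_pattern p q \<Longrightarrow>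
      b = 1 \<and> c = 0 \<or> c + 2 = p \<and> b = q + 1 \<or> c + 2 = q \<and> b = p + 1" (is "_ \<Longrightarrow> ?c \<Longrightarrow> _")
    and "(Suc b, c) \<in> one_side_pattern p q \<Longrightarrow> (b, Suc c) \<in> one_side_pattern p q \<Longrightarrow> False"
proof -
  have "3 dvd q - p" using pq(1,3) mod_eq_dvd_iff_nat[of p q 3] by simp
  then obtain u where "q - p = 3 * u" by (rule dvdE)
  moreover obtain s where s: "p = Suc (Suc s)" using pq(2) that[of "p - 2"] by auto
  ultimately have q: "q = Suc (Suc (s + 3 * u))" "u \<ge> 2" using pq(3) by auto
  have residue: "s mod 3 = 0 \<or> s mod 3 = 1 \<or> s mod 3 = 2" by auto
  have sub: "one_side_pattern p q \<subseteq> colour_lattice \<union> one_side_moved p q" unfolding one_side_pattern_def by blast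
  note elims = one_side_moved_def insert_iff prod.inject empty_iff HOL.simp_thms
  note normal = s q(1) One_nat_def diff_Suc_Suc diff_zero add_Suc_right add_0_right nat.inject
  note [simp] = s q(1) one_side_pattern_def one_side_moved_def mod_Suc
  show "b + 2 = p \<and> c = q + 1 \<or> b + 2 = q \<and> c = p + 1" if 1: ?a and 2: ?b
    using adjacent_in_modified_lattice(1)[OF sub 1 2] unfolding elims
    using that pq(4) q(2) residue by (elim disjE conjE; (simp only: normal)?; simp)
  show "b = 1 \<and> c = 0 \<or> c + 2 = p \<and> b = q + 1 \<or> c + 2 = q \<and> b = p + 1" if 1: ?a and 2: ?c
    using adjacent_in_modified_lattice(2)[OF sub 1 2] unfolding elims
    using that pq(4) q(2) residue by (elim disjE conjE; (simp only: normal)?; simp)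
  show False if 1: ?b and 2: ?c
    using adjacent_in_modified_lattice(3)[OF sub 1 2] unfolding elims
    using that pq(4) q(2) residue by (elim disjE conjE; (simp only: normal)?; simp)
qed

lemma one_side_meets_triangles:
  assumes "b + c < p + q"
  shows "(b, c) \<in> one_side_pattern p q \<or> (Suc b, c) \<in> one_side_pattern p q \<or> (b, Suc c) \<in> one_side_pattern p q"
  unfolding one_side_pattern_def by (rule modified_lattice_meets_triangles[of b c "p + q", OF assms]; elim insertE emptyE; clarsimp simp: one_side_moved_def)

text \<open>The first three cases are a moved corner together with its neighbour in the lattice, where the increased
  coordinate is \<open>1\<close>.\<close>
definition corners_label :: "nat \<Rightarrow> nat set \<Rightarrow> nat \<times> nat \<Rightarrow> nat" where
  "corners_label k B = (\<lambda>(b, c).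
     if c = 1 \<and> k \<le> b + 2 then 2
     else if b = 1 \<and> c \<le> 1 then 1
     else if b \<le> 1 \<and> b + c + 1 = k then 0
     else free_coord k B (b, c))"

lemma corners_codegree_pattern:
  fixes p q :: nat
  defines "B \<equiv> {0, p, q, p + q}" and "k \<equiv> p + q"
  assumes pq: "3 dvd p + q" "\<not> 3 dvd p" "2 \<le> p" "2 \<le> q" "6 \<le> p + q" "p \<noteq> q" "p \<noteq> 2 * q" "q \<noteq> 2 * p"
  shows "codegree_pattern k B (corners_pattern k) (corners_label k B)"
  unfolding codegree_pattern_def
proof (intro conjI allI impI)
  fix b c
  have k: "3 dvd k" "6 \<le> k" using pq unfolding k_def by auto
  note free = free_coord_unexceptional[of b c p q, folded B_def k_def]
  {
    assume bc: "b + c < k"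
    show "(b, c) \<in> corners_pattern k \<or> (Suc b, c) \<in> corners_pattern k \<or> (b, Suc c) \<in> corners_pattern k" using corners_meets_triangles[OF bc] .
    note adj = corners_adjacent[OF k bc]
    show "corners_label k B (b, c) = 2" "corners_label k B (Suc b, c) = 2" if "(b, c) \<in> corners_pattern k" "(Suc b, c) \<in> corners_pattern k"
      using adj(1)[OF that] by (simp_all add: corners_label_def)
    show "corners_label k B (b, c) = 1" "corners_label k B (b, Suc c) = 1" if "(b, c) \<in> corners_pattern k" "(b, Suc c) \<in> corners_pattern k"
      using adj(2)[OF that] k by (simp_all add: corners_label_def)
    show "corners_label k B (Suc b, c) = 0" "corners_label k B (b, Suc c) = 0" if "(Suc b, c) \<in> corners_pattern k" "(b, Suc c) \<in> corners_pattern k"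
      using adj(3)[OF that] k by (simp_all add: corners_label_def)
  next
    assume bc: "b + c \<le> k" and T: "(b, c) \<in> corners_pattern k"
    consider "c = 1 \<and> k \<le> b + 2 \<or> b = 1 \<and> c \<le> 1 \<or> b \<le> 1 \<and> b + c + 1 = k"
      | "\<not> (c = 1 \<and> k \<le> b + 2)" "\<not> (b = 1 \<and> c \<le> 1)" "\<not> (b \<le> 1 \<and> b + c + 1 = k)" by blast
    then show "coord k (corners_label k B (b, c)) (b, c) \<notin> B"
    proof cases
      case 1
      then have "coord k (corners_label k B (b, c)) (b, c) = 1" using k by (elim disjE conjE) (simp_all add: corners_label_def)
      then show ?thesis using pq unfolding B_def by simp
    next
      case 2
      then have "(b, c) \<notin> corners_moved k" using k unfolding corners_moved_def by auto
      then have L: "b mod 3 = c mod 3" "(b, c) \<notin> {(0, 0), (k, 0), (0, k)}" using T unfolding corners_pattern_def by auto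
      have "p mod 3 \<noteq> 0" "q mod 3 \<noteq> 0" "p mod 3 \<noteq> q mod 3" using pq(1,2) unfolding three_dvd_add_iff by (auto simp: dvd_eq_mod_eq_0)
      then have "(b, c) \<notin> {(0, 0), (k, 0), (0, k), (p, q), (q, p), (p, 0), (q, 0), (0, p), (0, q)}"
        using L by auto
      then have "coord k (free_coord k B (b, c)) (b, c) \<notin> B"
        using free bc pq by blast
      moreover have "corners_label k B (b, c) = free_coord k B (b, c)"
        unfolding corners_label_def case_prod_conv using 2 by (simp only: if_False)
      ultimately show ?thesis by simp
    qed
  }
qed

text \<open>The points with \<open>b + c + 1 = p\<close> are those whose first coordinate is \<open>q + 1\<close>.\<close>
definition two_sides_label :: "nat \<Rightarrow> nat \<Rightarrow> nat set \<Rightarrow> nat \<times> nat \<Rightarrow> nat" where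
  "two_sides_label p k B = (\<lambda>(b, c).
     if c = p + 1 \<and> b \<le> 1 then 2
     else if (b = 1 \<or> b = p + 1) \<and> c \<le> 1 then 1
     else if b + c + 1 = p \<and> (b \<le> 1 \<or> c \<le> 1) then 0
     else free_coord k B (b, c))"

lemma two_sides_codegree_pattern:
  fixes p q :: nat
  defines "B \<equiv> {0, p, q, p + q}" and "k \<equiv> p + q"
  assumes pq: "3 dvd p" "\<not> 3 dvd q" "6 \<le> p" "2 \<le> q" "p \<noteq> q" "p \<noteq> 2 * q" "q \<noteq> 2 * p"
    and gap: "p \<noteq> q + 1" "q \<noteq> p + 1"
  shows "codegree_pattern k B (two_sides_pattern p) (two_sides_label p k B)"
  unfolding codegree_pattern_def
proof (intro conjI allI impI)
  fix b c
  note free = free_coord_unexceptional[of b c p q, folded B_def k_def]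
  note adj = two_sides_adjacent[OF pq(1,3), of b c]
  {
    assume bc: "b + c < k"
    show "(b, c) \<in> two_sides_pattern p \<or> (Suc b, c) \<in> two_sides_pattern p \<or> (b, Suc c) \<in> two_sides_pattern p" by (rule two_sides_meets_triangles)
    show "two_sides_label p k B (b, c) = 2" "two_sides_label p k B (Suc b, c) = 2" if "(b, c) \<in> two_sides_pattern p" "(Suc b, c) \<in> two_sides_pattern p"
      using adj(1)[OF that] by (simp_all add: two_sides_label_def)
    show "two_sides_label p k B (b, c) = 1" "two_sides_label p k B (b, Suc c) = 1" if "(b, c) \<in> two_sides_pattern p" "(b, Suc c) \<in> two_sides_pattern p"
      using adj(2)[OF that] pq(3) by (simp_all add: two_sides_label_def)
    show "two_sides_label p k B (Suc b, c) = 0" "two_sides_label p k B (b, Suc c) = 0" if "(Suc b, c) \<in> two_sides_pattern p" "(b, Suc c) \<in> two_sides_pattern p"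
      using adj(3)[OF that] pq(3) by (auto simp add: two_sides_label_def)
  next
    assume bc: "b + c \<le> k" and T: "(b, c) \<in> two_sides_pattern p"
    consider "c = p + 1 \<and> b \<le> 1 \<or> (b = 1 \<or> b = p + 1) \<and> c \<le> 1 \<or> b + c + 1 = p \<and> (b \<le> 1 \<or> c \<le> 1)"
      | "\<not> (c = p + 1 \<and> b \<le> 1)" "\<not> ((b = 1 \<or> b = p + 1) \<and> c \<le> 1)" "\<not> (b + c + 1 = p \<and> (b \<le> 1 \<or> c \<le> 1))" by blast
    then show "coord k (two_sides_label p k B (b, c)) (b, c) \<notin> B"
    proof cases
      case 1
      then have "coord k (two_sides_label p k B (b, c)) (b, c) \<in> {1, p + 1, q + 1}"
        using pq(3) by (elim disjE conjE) (auto simp: two_sides_label_def k_def)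
      moreover have "{1, p + 1, q + 1} \<inter> B = {}" using pq(3,4) gap unfolding B_def by auto
      ultimately show ?thesis by blast
    next
      case 2
      then have "(b, c) \<notin> two_sides_moved p" using pq(3) unfolding two_sides_moved_def by auto
      then have L: "b mod 3 = c mod 3" "(b, c) \<notin> {(0, 0), (p, 0), (0, p)}" using T unfolding two_sides_pattern_def by auto
      have "p mod 3 = 0" "q mod 3 \<noteq> 0" using pq(1,2) by (simp_all add: dvd_eq_mod_eq_0)
      moreover from this have "k mod 3 \<noteq> 0"
        using three_dvd_add_iff[of p q] unfolding k_def by (simp add: dvd_eq_mod_eq_0)
      ultimately have "(b, c) \<notin> {(0, 0), (k, 0), (0, k), (p, q), (q, p), (p, 0), (q, 0), (0, p), (0, q)}"
        using L by auto
      then have "coord k (free_coord k B (b, c)) (b, c) \<notin> B"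
        using free bc pq by simp
      moreover have "two_sides_label p k B (b, c) = free_coord k B (b, c)"
        unfolding two_sides_label_def case_prod_conv using 2 by (simp only: if_False)
      ultimately show ?thesis by simp
    qed
  }
qed

text \<open>The condition \<open>p + q \<le> b + c + 1\<close> says that the first coordinate is at most \<open>1\<close>: moved points lie on
  the side where it is \<open>0\<close>, and their lattice neighbours on the next line.\<close>
definition one_side_label :: "nat \<Rightarrow> nat \<Rightarrow> nat set \<Rightarrow> nat \<times> nat \<Rightarrow> nat" where
  "one_side_label p q B = (\<lambda>(b, c).
     if (c = p + 1 \<or> c = q + 1) \<and> p + q \<le> b + c + 1 then 2
     else if b = 1 \<and> c \<le> 1 \<or> (b = p + 1 \<or> b = q + 1) \<and> p + q \<le> b + c + 1 then 1
     else free_coord (p + q) B (b, c))"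

lemma one_side_codegree_pattern:
  fixes p q :: nat
  defines "B \<equiv> {0, p, q, p + q}" and "k \<equiv> p + q"
  assumes pq: "p mod 3 = q mod 3" "\<not> 3 dvd p" "2 \<le> p" "p + 6 \<le> q" "q \<noteq> 2 * p"
  shows "codegree_pattern k B (one_side_pattern p q) (one_side_label p q B)"
  unfolding codegree_pattern_def
proof (intro conjI allI impI)
  fix b c
  note free = free_coord_unexceptional[of b c p q, folded B_def k_def]
  {
    assume bc: "b + c < k"
    note bc' = bc[unfolded k_def]
    show "(b, c) \<in> one_side_pattern p q \<or> (Suc b, c) \<in> one_side_pattern p q \<or> (b, Suc c) \<in> one_side_pattern p q" by (rule one_side_meets_triangles[OF bc'])
    note adj = one_side_adjacent[OF pq(1,3,4) bc']
    show "one_side_label p q B (b, c) = 2" "one_side_label p q B (Suc b, c) = 2" if "(b, c) \<in> one_side_pattern p q" "(Suc b, c) \<in> one_side_pattern p q"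
      using adj(1)[OF that] by (auto simp add: one_side_label_def)
    show "one_side_label p q B (b, c) = 1" "one_side_label p q B (b, Suc c) = 1" if "(b, c) \<in> one_side_pattern p q" "(b, Suc c) \<in> one_side_pattern p q"
      using adj(2)[OF that] pq(3,4) by (auto simp add: one_side_label_def)
    show "one_side_label p q B (Suc b, c) = 0" "one_side_label p q B (b, Suc c) = 0" if "(Suc b, c) \<in> one_side_pattern p q" "(b, Suc c) \<in> one_side_pattern p q"
      using adj(3)[OF that] by simp_all
  next
    assume bc: "b + c \<le> k" and T: "(b, c) \<in> one_side_pattern p q"
    consider "(c = p + 1 \<or> c = q + 1) \<and> p + q \<le> b + c + 1
          \<or> b = 1 \<and> c \<le> 1 \<or> (b = p + 1 \<or> b = q + 1) \<and> p + q \<le> b + c + 1"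
      | "\<not> ((c = p + 1 \<or> c = q + 1) \<and> p + q \<le> b + c + 1)"
        "\<not> (b = 1 \<and> c \<le> 1 \<or> (b = p + 1 \<or> b = q + 1) \<and> p + q \<le> b + c + 1)" by blast
    then show "coord k (one_side_label p q B (b, c)) (b, c) \<notin> B"
    proof cases
      case 1
      then have "coord k (one_side_label p q B (b, c)) (b, c) \<in> {1, p + 1, q + 1}"
        using pq(3,4) by (elim disjE conjE) (simp_all add: one_side_label_def k_def)
      moreover have "{1, p + 1, q + 1} \<inter> B = {}" using pq(3,4) unfolding B_def by auto
      ultimately show ?thesis by blast
    next
      case 2
      then have "(b, c) \<notin> one_side_moved p q" using pq(3,4) unfolding one_side_moved_def by auto
      then have L: "b mod 3 = c mod 3" "(b, c) \<notin> {(0, 0), (p, q), (q, p)}" using T unfolding one_side_pattern_def by auto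
      obtain x where x: "p mod 3 = x" "q mod 3 = x" "x \<noteq> 0" using pq(1,2) by (simp add: dvd_eq_mod_eq_0)
      then have "\<not> 3 dvd k" unfolding k_def three_dvd_add_iff by simp
      then have "p mod 3 \<noteq> 0" "q mod 3 \<noteq> 0" "k mod 3 \<noteq> 0" using x by (simp_all add: dvd_eq_mod_eq_0)
      then have "(b, c) \<notin> {(0, 0), (k, 0), (0, k), (p, q), (q, p), (p, 0), (q, 0), (0, p), (0, q)}"
        using L by auto
      then have "coord k (free_coord k B (b, c)) (b, c) \<notin> B"
        using free bc pq by simp
      moreover have "one_side_label p q B (b, c) = free_coord k B (b, c)"
        unfolding one_side_label_def case_prod_conv k_def using 2 by (simp only: if_False)
      ultimately show ?thesis by simp
    qed
  }
qed

text \<open>Up to exchanging \<open>p\<close> and \<open>q\<close>, the residues modulo \<open>3\<close> fall into the three cases above. Excluding the value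
  \<open>3\<close> leaves \<open>p \<ge> 6\<close> if \<open>3\<close> divides \<open>p\<close>, and excluding the difference \<open>3\<close> leaves a difference of at least \<open>6\<close>
  if \<open>p \<equiv> q\<close>; this keeps the moved points apart.\<close>
lemma codegree_pattern_exists:
  fixes p q :: nat
  assumes "coprime p q" "2 \<le> p" "2 \<le> q" "p \<noteq> 3" "q \<noteq> 3"
    and "p \<noteq> q + 1" "q \<noteq> p + 1" "p \<noteq> q + 3" "q \<noteq> p + 3"
  shows "\<exists>T lab. codegree_pattern (p + q) {0, p, q, p + q} T lab"
proof -
  have ne: "p \<noteq> q" "p \<noteq> 2 * q" "q \<noteq> 2 * p"
  proof -
    have "\<not> q dvd p" "\<not> p dvd q"
      using coprime_common_divisor[OF assms(1), of q] coprime_common_divisor[OF assms(1), of p] assms(2,3) by auto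
    then show "p \<noteq> q" "p \<noteq> 2 * q" "q \<noteq> 2 * p" by auto
  qed
  have swap: "q + p = p + q" "{0, q, p, p + q} = {0, p, q, p + q}" by auto
  have not_both: "\<not> (3 dvd p \<and> 3 dvd q)" using coprime_common_divisor[OF assms(1), of 3] by auto
  consider "3 dvd p + q" | "3 dvd p" | "3 dvd q" | "p mod 3 = q mod 3" "\<not> 3 dvd p" "\<not> 3 dvd q"
  proof -
    have "p mod 3 \<in> {0, 1, 2}" "q mod 3 \<in> {0, 1, 2}" by auto
    then have "3 dvd p + q \<or> 3 dvd p \<or> 3 dvd q \<or> p mod 3 = q mod 3 \<and> \<not> 3 dvd p \<and> \<not> 3 dvd q"
      unfolding three_dvd_add_iff by (auto simp: dvd_eq_mod_eq_0)
    then show ?thesis using that by blast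
  qed
  then show ?thesis
  proof cases
    case 1
    then have "\<not> 3 dvd p" using not_both dvd_add_right_iff by blast
    moreover have "6 \<le> p + q" using 1 assms(2,3) ne by (auto elim!: dvdE)
    ultimately show ?thesis using corners_codegree_pattern[of p q] 1 assms(2,3) ne by blast
  next
    case 2
    then have "6 \<le> p" using assms(2,4) by (auto elim!: dvdE)
    then show ?thesis using two_sides_codegree_pattern[of p q] 2 not_both assms ne by blast
  next
    case 3
    then have "6 \<le> q" using assms(3,5) by (auto elim!: dvdE)
    then have "codegree_pattern (q + p) {0, q, p, q + p} (two_sides_pattern q) (two_sides_label q (q + p) {0, q, p, q + p})"
      using 3 not_both assms ne by (intro two_sides_codegree_pattern) auto
    then show ?thesis unfolding swap by blast
  next
    case 4
    have far: "p' + 6 \<le> q'" if "p' < q'" "p' mod 3 = q' mod 3" "q' \<noteq> p' + 3" for p' q' :: nat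
    proof -
      have "3 dvd q' - p'" using that(1,2) mod_eq_dvd_iff_nat[of p' q' 3] by simp
      then obtain d where "q' - p' = 3 * d" by (rule dvdE)
      then have "q' = p' + 3 * d" using that(1) by simp
      moreover from this have "d \<noteq> 0" "d \<noteq> 1" using that(1,3) by simp_all
      ultimately show ?thesis by linarith
    qed
    show ?thesis
    proof (cases "p < q")
      case True
      then show ?thesis using one_side_codegree_pattern[of p q] far[of p q] 4 assms ne by auto
    next
      case False
      then have "q < p" using ne by simp
      then have "codegree_pattern (q + p) {0, q, p, q + p} (one_side_pattern q p) (one_side_label q p {0, q, p, q + p})"
        using far[of q p] 4 assms ne by (intro one_side_codegree_pattern) auto
      then show ?thesis unfolding swap by blast
    qed
  qed
qed

section \<open>The lower bound\<close>

text \<open>With \<open>P\<close> the inverse of \<open>L\<close>, conditions on \<open>P\<close> translate into conditions on \<open>L\<close>.\<close>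
lemma cong_mult_inverse:
  fixes L P K a b :: int
  assumes "[P * L = 1] (mod K)" "[a * P = b] (mod K)"
  shows "[a = b * L] (mod K)"
proof -
  have "[a * (P * L) = a * 1] (mod K)" using assms(1) by (rule cong_scalar_left)
  moreover have "[a * P * L = b * L] (mod K)" using assms(2) by (rule cong_scalar_right)
  ultimately show ?thesis by (metis cong_sym cong_trans mult.assoc mult_1_right)
qed

lemma small_multiple_eq_zero:
  fixes x K :: int
  assumes "K dvd x" "\<bar>x\<bar> < K"
  shows "x = 0"
  using assms dvd_imp_le_int[of x K] by linarith

lemma exceptional_counts:
  fixes k l p m :: nat and d :: int
  assumes p: "[int p * int l = 1] (mod int k)" "0 < p" "p < k" and "m \<le> k"
    and d: "d \<in> {-1, 0, 1}" "[int l * int m = d] (mod int k)"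
  shows "m \<in> {0, p, k - p, p + (k - p)}"
proof -
  have "[int m * int l = d] (mod int k)" using d(2) by (simp add: mult.commute)
  then have "[int m = d * int p] (mod int k)"
    using cong_mult_inverse[of "int l" "int p" "int k" "int m" d] p(1) by (simp add: mult.commute)
  then have dvd: "int k dvd int m - d * int p" by (simp add: cong_iff_dvd_diff)
  consider "d = 0" | "d = 1" | "d = -1" using d(1) by blast
  then show ?thesis
  proof cases
    case 1
    then have "int k dvd int m" using dvd by simp
    then show ?thesis using small_multiple_eq_zero[of "int k" "int m"] assms(3,4) by (cases "m = k") auto
  next
    case 2
    then have "int m - int p = 0" using dvd p(2,3) assms(4) by (intro small_multiple_eq_zero[of "int k"]) auto
    then show ?thesis by simp
  next
    case 3
    then have "int k dvd int m + int p - int k" using dvd by simp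
    then have "int m + int p - int k = 0" using p(2,3) assms(4) by (intro small_multiple_eq_zero[of "int k"]) auto
    then show ?thesis using p(3) by auto
  qed
qed

lemma codegree_turan_density_ge_third:
  fixes F :: "'b hypergraph"
  assumes pat: "codegree_pattern k B T lab" and "0 < k" and F: "edges F \<noteq> {}"
    and free: "\<And>n. \<not> contains_copy (pattern_graph k T n) F"
  shows "1 / 3 \<le> codegree_turan_density k F"
proof (rule LIMSEQ_le[OF _ codegree_density_exists[OF F]])
  have "(\<lambda>n. 1 / 3 - real (k + 1) * (1 / real n)) \<longlonglongrightarrow> 1 / 3 - real (k + 1) * 0"
    by (intro tendsto_intros lim_1_over_n)
  then show "(\<lambda>n. 1 / 3 - real (k + 1) * (1 / real n)) \<longlonglongrightarrow> 1 / 3" by simp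
  show "\<exists>N. \<forall>n\<ge>N. 1 / 3 - real (k + 1) * (1 / real n) \<le> real (ex_codegree k n F) / real n"
  proof (rule exI[of _ k], intro allI impI)
    fix n assume n: "k \<le> n"
    have "min_codegree k (pattern_graph k T n) \<le> ex_codegree k n F"
      using n free[of n] pattern_graph_uniform by (intro min_codegree_le_ex_codegree) (auto simp: pattern_graph_def)
    then have div_le: "n div 3 \<le> ex_codegree k n F + k"
      using min_codegree_pattern_graph[OF pat assms(2) n] by linarith
    have "n < 3 + 3 * (n div 3)" by (rule dividend_less_times_div) simp
    also have "\<dots> \<le> 3 + 3 * (ex_codegree k n F + k)" using div_le by (intro add_left_mono mult_left_mono) simp_all
    finally have "real n < real (3 + 3 * (ex_codegree k n F + k))" by (simp only: of_nat_less_iff)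
    then have "(real n / 3 - real (k + 1)) / real n \<le> real (ex_codegree k n F) / real n"
      by (intro divide_right_mono) simp_all
    moreover have "(real n / 3 - real (k + 1)) / real n = 1 / 3 - real (k + 1) * (1 / real n)"
      using n assms(2) by (simp add: diff_divide_distrib)
    ultimately show "1 / 3 - real (k + 1) * (1 / real n) \<le> real (ex_codegree k n F) / real n" by simp
  qed
qed

theorem theorem1p7:
  fixes k l :: nat and e :: "nat set"
  assumes "3 \<le> k" and "k < l"
    and "\<not> [int l = 0] (mod int k)"
    and "\<not> [int l = 1] (mod int k)" and "\<not> [int l = -1] (mod int k)"
    and "gcd k l = 1"
    and "\<not> [int l = 2] (mod int k)" and "\<not> [int l = -2] (mod int k)"
    and "\<not> [3 * int l = 1] (mod int k)" and "\<not> [3 * int l = -1] (mod int k)"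
    and "\<not> [3 * int l = 2] (mod int k)" and "\<not> [3 * int l = -2] (mod int k)"
    and "e \<in> edges (tight_cycle k l)"
  shows "codegree_turan_density k (remove_edge (tight_cycle k l) e) \<ge> 1 / 3"
proof -
  let ?K = "int k" and ?L = "int l"
  have "coprime ?L ?K" using assms(6) by (simp add: coprime_iff_gcd_eq_1 gcd.commute)
  then obtain x where x: "[?L * x = 1] (mod ?K)" using cong_solve_coprime_int by blast
  define p where "p = nat (x mod ?K)"
  define q where "q = k - p"
  have intp: "int p = x mod ?K" using assms(1) unfolding p_def by simp
  have pk: "p < k" using intp assms(1) by (metis of_nat_less_iff of_nat_0_less_iff pos_mod_bound gr0I not_numeral_le_zero)
  have pl: "[int p * ?L = 1] (mod ?K)"
  proof -
    have "[x mod ?K * ?L = x * ?L] (mod ?K)" by (simp add: cong_def mod_mult_left_eq)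
    also have "[x * ?L = 1] (mod ?K)" using x by (simp add: mult.commute)
    finally show ?thesis unfolding intp .
  qed
  note inverse = cong_mult_inverse[OF pl]
  have "p \<noteq> 0"
  proof
    assume "p = 0"
    then have "?K dvd 1" using pl by (simp add: cong_iff_dvd_diff)
    then show False using assms(1) by simp
  qed
  then have k: "p + q = k" "0 < p" "0 < q" using pk unfolding q_def by auto
  \<comment> \<open>The excluded relations between \<open>p\<close> and \<open>q\<close>, as congruences for \<open>p\<close> or \<open>2 p\<close>, become the excluded
    congruences for \<open>l\<close> or \<open>3 l\<close> after multiplication by \<open>l\<close>.\<close>
  have two_p: "[2 * int p = int p - int q] (mod ?K)"
  proof -
    have "2 * int p - (int p - int q) = ?K" using k(1) by simp
    then show ?thesis by (simp add: cong_iff_dvd_diff)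
  qed
  have minus_q: "[1 * int p = - int q] (mod ?K)"
  proof -
    have "1 * int p - (- int q) = ?K" using k(1) by simp
    then show ?thesis by (simp add: cong_iff_dvd_diff)
  qed
  have self: "[1 * int p = int p] (mod ?K)" by simp
  have ex: "p \<noteq> 1" "q \<noteq> 1" "p \<noteq> 3" "q \<noteq> 3" "p \<noteq> q + 1" "q \<noteq> p + 1" "p \<noteq> q + 3" "q \<noteq> p + 3"
  proof -
    show "p \<noteq> 1" using inverse[OF self] assms(4) by (auto dest: cong_sym)
    show "p \<noteq> 3" using inverse[OF self] assms(9) by (auto dest: cong_sym)
    have neg: "[c * ?L = - d] (mod ?K)" if "[d = - c * ?L] (mod ?K)" for c d
      using cong_minus_minus_iff[of "- d" "c * ?L" ?K] that by (simp add: cong_sym_eq)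
    show "q \<noteq> 1" using inverse[OF minus_q] assms(5) neg[of 1 1] by auto
    show "q \<noteq> 3" using inverse[OF minus_q] assms(10) neg[of 1 3] by auto
    show "p \<noteq> q + 1" using inverse[OF two_p] assms(7) by (auto dest: cong_sym)
    show "p \<noteq> q + 3" using inverse[OF two_p] assms(11) by (auto dest: cong_sym)
    show "q \<noteq> p + 1" using inverse[OF two_p] assms(8) neg[of 2 1] by auto
    show "q \<noteq> p + 3" using inverse[OF two_p] assms(12) neg[of 2 3] by auto
  qed
  have "coprime p q"
  proof (rule coprimeI)
    fix d assume "d dvd p" "d dvd q"
    then have "int d dvd int p * ?L" "int d dvd ?K" using k(1) by (auto intro: dvd_mult2)
    moreover have "?K dvd int p * ?L - 1" using pl by (simp add: cong_iff_dvd_diff)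
    ultimately have "int d dvd 1" by (metis dvd_trans dvd_diff_right_iff dvd_diff)
    then show "is_unit d" by simp
  qed
  then obtain T lab where pat: "codegree_pattern k {0, p, q, p + q} T lab"
    using codegree_pattern_exists[of p q] k ex by (metis One_nat_def Suc_leI le_neq_implies_less numeral_2_eq_2 Suc_lessI less_eq_Suc_le)
  have no_copy: "\<not> contains_copy (pattern_graph k T n) (remove_edge (tight_cycle k l) e)" for n
  proof (rule pattern_graph_free[OF pat _ assms(2) _ assms(13)])
    show "2 \<le> k" using assms(1) by simp
    show "m \<in> {0, p, q, p + q}" if "m \<le> k" "d \<in> {-1, 0, 1}" "[?L * int m = d] (mod ?K)" for m d
      using exceptional_counts[OF pl k(2) pk that] unfolding q_def .
  qed
  have nonempty: "edges (remove_edge (tight_cycle k l) e) \<noteq> {}"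
  proof -
    obtain t where t: "t < l" "e = window k l t" using assms(13) unfolding edges_tight_cycle by auto
    have "window k l (t + 1) \<noteq> e" unfolding t(2) using assms(1,2) by (intro window_inj) auto
    moreover have "window k l (t + 1) = window k l ((t + 1) mod l)" by (simp only: window_mod)
    then have "window k l (t + 1) \<in> edges (tight_cycle k l)" unfolding edges_tight_cycle using t(1) by auto
    ultimately show ?thesis unfolding remove_edge_def by auto
  qed
  show ?thesis
    by (rule codegree_turan_density_ge_third[OF pat _ nonempty no_copy]) (use assms(1) in simp)
qed

end
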